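(* Let $0\to(V,[~,~]_V=0,S)\xrightarrow{i}(\mathfrak{e},[~,~]_\mathfrak{e},U)\xrightarrow{p}(\mathfrak{g},[~,~]_\mathfrak{g},N)\to0$ be an abelian extension of the Nijenhuis Lie algebra $(\mathfrak{g},[~,~]_\mathfrak{g},N)$ by the Nijenhuis representation $(V,\rho,S)$. (i) A pair $(\beta,\alpha)\in\mathrm{Aut}(V,S)\times\mathrm{Aut}(\mathfrak{g},N)$ of Nijenhuis Lie algebra automorphisms is inducible if and only if $(\beta,\alpha)\in\mathcal{C}_\rho$ and $\mathcal{W}(\beta,\alpha)=0$. (ii) There is an exact sequence $$1\to\mathrm{Aut}_{V,\mathfrak{g}}(\mathfrak{e},U)\hookrightarrow\mathrm{Aut}_V(\mathfrak{e},U)\xrightarrow{\tau}\mathcal{C}_\rho\xrightarrow{\mathcal{W}}H^2((\mathfrak{g},N);(V,S)).$$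
   Context: All vector spaces are over a fixed field. A Nijenhuis operator on a Lie algebra $(\mathfrak{g},[~,~]_\mathfrak{g})$ is a linear map $N:\mathfrak{g}\to\mathfrak{g}$ with $[N(x),N(y)]_\mathfrak{g}=N([N(x),y]_\mathfrak{g}+[x,N(y)]_\mathfrak{g}-N[x,y]_\mathfrak{g})$ for all $x,y\in\mathfrak{g}$. A Nijenhuis Lie algebra is a Lie algebra with a Nijenhuis operator. A homomorphism of Nijenhuis Lie algebras is a Lie algebra homomorphism commuting with the Nijenhuis operators; $\mathrm{Aut}(\mathfrak{g},N)$ is the group of Nijenhuis Lie algebra automorphisms. A Nijenhuis representation of $(\mathfrak{g},[~,~]_\mathfrak{g},N)$ is a triple $(V,\rho,S)$ with $(V,\rho)$ a representation of the Lie algebra $\mathfrak{g}$ and $S:V\to V$ linear with $\rho_{N(x)}S(v)=S(\rho_{N(x)}v+\rho_xS(v)-S(\rho_xv))$ for all $x\in\mathfrak{g}$, $v\in V$. $(V,S)$ is regarded as a Nijenhuis Lie algebra with zero bracket, so $\mathrm{Aut}(V,S)$ is the group of linear automorphisms of $V$ commuting with $S$. An abelian extension of $(\mathfrak{g},N)$ by the Nijenhuis representation $(V,\rho,S)$ is a short exact sequence of Nijenhuis Lie algebras $0\to(V,0,S)\xrightarrow{i}(\mathfrak{e},[~,~]_\mathfrak{e},U)\xrightarrow{p}(\mathfrak{g},[~,~]_\mathfrak{g},N)\to0$, with $V$ identified with $i(V)\subset\mathfrak{e}$, such that $\rho_xv=[s(x),v]_\mathfrak{e}$ for any section $s$ of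 $p$ (a linear map $s:\mathfrak{g}\to\mathfrak{e}$ with $ps=\mathrm{Id}_\mathfrak{g}$; this is independent of $s$). A 2-cocycle of $(\mathfrak{g},N)$ with coefficients in $(V,\rho,S)$ is a pair $(\chi,F)$ of linear maps $\chi:\wedge^2\mathfrak{g}\to V$, $F:\mathfrak{g}\to V$ such that for all $x,y,z\in\mathfrak{g}$: (1) $\rho_x\chi(y,z)+\rho_y\chi(z,x)+\rho_z\chi(x,y)-\chi([x,y]_\mathfrak{g},z)-\chi([y,z]_\mathfrak{g},x)-\chi([z,x]_\mathfrak{g},y)=0$; (2) $\chi(N(x),N(y))-S(\chi(N(x),y)+\chi(x,N(y))-S(\chi(x,y)))-F([N(x),y]_\mathfrak{g}+[x,N(y)]_\mathfrak{g}-N[x,y]_\mathfrak{g})+\rho_{N(x)}F(y)-\rho_{N(y)}F(x)-S(\rho_xF(y)-\rho_yF(x)-F[x,y]_\mathfrak{g})=0$. $(\chi,F)$, $(\chi',F')$ are cohomologous if there is a linear map $\varphi:\mathfrak{g}\to V$ with $\chi(x,y)-\chi'(x,y)=\rho_x\varphi(y)-\rho_y\varphi(x)-\varphi([x,y]_\mathfrak{g})$ and $F(x)-F'(x)=S(\varphi(x))-\varphi(N(x))$. $H^2((\mathfrak{g},N);(V,S))$ is the space of 2-cocycles modulo this relation. A section $s$ of the extension produces the 2-cocycle $\chi(x,y)=[s(x),s(y)]_\mathfrak{e}-s[x,y]_\mathfrak{g}$, $F(x)=(Us-sN)(x)$. $\mathrm{Aut}_V(\mathfrak{e},U)$ is the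 group of $\gamma\in\mathrm{Aut}(\mathfrak{e},U)$ with $\gamma(V)=V$. $\tau(\gamma)=(\gamma|_V,\overline{\gamma})$, where $\overline{\gamma}=p\gamma s$ (independent of the section $s$). $(\beta,\alpha)$ is inducible if $(\beta,\alpha)=\tau(\gamma)$ for some $\gamma\in\mathrm{Aut}_V(\mathfrak{e},U)$. $\mathrm{Aut}_{V,\mathfrak{g}}(\mathfrak{e},U)=\{\gamma\in\mathrm{Aut}_V(\mathfrak{e},U)\mid\tau(\gamma)=(\mathrm{Id}_V,\mathrm{Id}_\mathfrak{g})\}$. $\mathcal{C}_\rho=\{(\beta,\alpha)\in\mathrm{Aut}(V,S)\times\mathrm{Aut}(\mathfrak{g},N)\mid\beta(\rho_xv)=\rho_{\alpha(x)}\beta(v)\ \forall x\in\mathfrak{g},v\in V\}$, a subgroup which contains the image of $\tau$. For $(\beta,\alpha)\in\mathcal{C}_\rho$, set $\chi_{(\beta,\alpha)}(x,y)=\beta\chi(\alpha^{-1}(x),\alpha^{-1}(y))$, $F_{(\beta,\alpha)}(x)=\beta(F(\alpha^{-1}(x)))$, where $(\chi,F)$ is the 2-cocycle produced by some section $s$; then $(\chi_{(\beta,\alpha)},F_{(\beta,\alpha)})$ is a 2-cocycle, and the Wells map $\mathcal{W}:\mathcal{C}_\rho\to H^2((\mathfrak{g},N);(V,S))$ is $\mathcal{W}(\beta,\alpha)=[(\chi_{(\beta,\alpha)},F_{(\beta,\alpha)})-(\chi,F)]$ (independent of $s$). Exactness at $\mathcal{C}_\rho$ means that the image of $\tau$ equals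 $\{(\beta,\alpha)\in\mathcal{C}_\rho\mid\mathcal{W}(\beta,\alpha)=0\}$ ($\mathcal{W}$ is a map of sets). *)

theory Defs
  imports Complex_Main "HOL-Algebra.Coset"
begin

text \<open>Vector spaces over the field \<open>'k\<close> are whole types of class \<^class>\<open>ab_group_add\<close>, equipped with
  an explicit scalar multiplication satisfying \<^locale>\<open>vector_space\<close>.\<close>

definition bilinear_map ::
  "('k::field \<Rightarrow> 'a::ab_group_add \<Rightarrow> 'a) \<Rightarrow> ('k \<Rightarrow> 'b::ab_group_add \<Rightarrow> 'b) \<Rightarrow>
   ('k \<Rightarrow> 'c::ab_group_add \<Rightarrow> 'c) \<Rightarrow> ('a \<Rightarrow> 'b \<Rightarrow> 'c) \<Rightarrow> bool" where
  "bilinear_map s1 s2 s3 f \<longleftrightarrow>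
     (\<forall>y. Vector_Spaces.linear s1 s3 (\<lambda>x. f x y)) \<and> (\<forall>x. Vector_Spaces.linear s2 s3 (f x))"

record ('k, 'a) nij_lie =
  scl :: "'k \<Rightarrow> 'a \<Rightarrow> 'a"
  brk :: "'a \<Rightarrow> 'a \<Rightarrow> 'a"
  nij :: "'a \<Rightarrow> 'a"

definition nijenhuis_lie_algebra :: "('k::field, 'a::ab_group_add) nij_lie \<Rightarrow> bool" where
  "nijenhuis_lie_algebra G \<longleftrightarrow>
     vector_space (scl G) \<and>
     bilinear_map (scl G) (scl G) (scl G) (brk G) \<and>
     (\<forall>x. brk G x x = 0) \<and>
     (\<forall>x y z. brk G x (brk G y z) + brk G y (brk G z x) + brk G z (brk G x y) = 0) \<and>
     Vector_Spaces.linear (scl G) (scl G) (nij G) \<and>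
     (\<forall>x y. brk G (nij G x) (nij G y) =
        nij G (brk G (nij G x) y + brk G x (nij G y) - nij G (brk G x y)))"

definition nij_hom ::
  "('k::field, 'a::ab_group_add) nij_lie \<Rightarrow> ('k, 'b::ab_group_add) nij_lie \<Rightarrow> ('a \<Rightarrow> 'b) \<Rightarrow> bool" where
  "nij_hom G H f \<longleftrightarrow>
     Vector_Spaces.linear (scl G) (scl H) f \<and>
     (\<forall>x y. f (brk G x y) = brk H (f x) (f y)) \<and>
     (\<forall>x. f (nij G x) = nij H (f x))"

definition nij_aut :: "('k::field, 'a::ab_group_add) nij_lie \<Rightarrow> ('a \<Rightarrow> 'a) monoid" where
  "nij_aut G = \<lparr>carrier = {f. nij_hom G G f \<and> bij f}, mult = (\<circ>), one = id\<rparr>"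

record ('k, 'g, 'v) nij_rep =
  rscl :: "'k \<Rightarrow> 'v \<Rightarrow> 'v"
  act :: "'g \<Rightarrow> 'v \<Rightarrow> 'v"
  rnij :: "'v \<Rightarrow> 'v"

definition nijenhuis_representation ::
  "('k::field, 'g::ab_group_add) nij_lie \<Rightarrow> ('k, 'g, 'v::ab_group_add) nij_rep \<Rightarrow> bool" where
  "nijenhuis_representation G V \<longleftrightarrow>
     vector_space (rscl V) \<and>
     bilinear_map (scl G) (rscl V) (rscl V) (act V) \<and>
     (\<forall>x y v. act V (brk G x y) v = act V x (act V y v) - act V y (act V x v)) \<and>
     Vector_Spaces.linear (rscl V) (rscl V) (rnij V) \<and>
     (\<forall>x v. act V (nij G x) (rnij V v) =
        rnij V (act V (nij G x) v + act V x (rnij V v) - rnij V (act V x v)))"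

definition zero_bracket :: "('k::field, 'g, 'v::ab_group_add) nij_rep \<Rightarrow> ('k, 'v) nij_lie" where
  "zero_bracket V = \<lparr>scl = rscl V, brk = (\<lambda>u v. 0), nij = rnij V\<rparr>"

definition is_section ::
  "('k::field, 'g::ab_group_add) nij_lie \<Rightarrow> ('k, 'e::ab_group_add) nij_lie \<Rightarrow>
   ('e \<Rightarrow> 'g) \<Rightarrow> ('g \<Rightarrow> 'e) \<Rightarrow> bool" where
  "is_section G E p s \<longleftrightarrow> Vector_Spaces.linear (scl G) (scl E) s \<and> p \<circ> s = id"

definition abelian_extension ::
  "('k::field, 'g::ab_group_add) nij_lie \<Rightarrow> ('k, 'g, 'v::ab_group_add) nij_rep \<Rightarrow>
   ('k, 'e::ab_group_add) nij_lie \<Rightarrow> ('v \<Rightarrow> 'e) \<Rightarrow> ('e \<Rightarrow> 'g) \<Rightarrow> bool" where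
  "abelian_extension G V E i p \<longleftrightarrow>
     nijenhuis_lie_algebra G \<and> nijenhuis_representation G V \<and> nijenhuis_lie_algebra E \<and>
     nij_hom (zero_bracket V) E i \<and> nij_hom E G p \<and>
     inj i \<and> range i = {e. p e = 0} \<and> surj p \<and>
     (\<forall>s. is_section G E p s \<longrightarrow> (\<forall>x v. i (act V x v) = brk E (s x) (i v)))"

definition cocycles ::
  "('k::field, 'g::ab_group_add) nij_lie \<Rightarrow> ('k, 'g, 'v::ab_group_add) nij_rep \<Rightarrow>
   (('g \<Rightarrow> 'g \<Rightarrow> 'v) \<times> ('g \<Rightarrow> 'v)) set" where
  "cocycles G V = {(\<chi>, F).
     bilinear_map (scl G) (scl G) (rscl V) \<chi> \<and> (\<forall>x. \<chi> x x = 0) \<and>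
     Vector_Spaces.linear (scl G) (rscl V) F \<and>
     (\<forall>x y z. act V x (\<chi> y z) + act V y (\<chi> z x) + act V z (\<chi> x y)
        - \<chi> (brk G x y) z - \<chi> (brk G y z) x - \<chi> (brk G z x) y = 0) \<and>
     (\<forall>x y. \<chi> (nij G x) (nij G y)
        - rnij V (\<chi> (nij G x) y + \<chi> x (nij G y) - rnij V (\<chi> x y))
        - F (brk G (nij G x) y + brk G x (nij G y) - nij G (brk G x y))
        + act V (nij G x) (F y) - act V (nij G y) (F x)
        - rnij V (act V x (F y) - act V y (F x) - F (brk G x y)) = 0)}"

definition cohomologous ::
  "('k::field, 'g::ab_group_add) nij_lie \<Rightarrow> ('k, 'g, 'v::ab_group_add) nij_rep \<Rightarrow>
   ('g \<Rightarrow> 'g \<Rightarrow> 'v) \<times> ('g \<Rightarrow> 'v) \<Rightarrow> ('g \<Rightarrow> 'g \<Rightarrow> 'v) \<times> ('g \<Rightarrow> 'v) \<Rightarrow> bool" where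
  "cohomologous G V = (\<lambda>(\<chi>, F) (\<chi>', F'). \<exists>\<phi>. Vector_Spaces.linear (scl G) (rscl V) \<phi> \<and>
     (\<forall>x y. \<chi> x y - \<chi>' x y = act V x (\<phi> y) - act V y (\<phi> x) - \<phi> (brk G x y)) \<and>
     (\<forall>x. F x - F' x = rnij V (\<phi> x) - \<phi> (nij G x)))"

definition cohom_class ::
  "('k::field, 'g::ab_group_add) nij_lie \<Rightarrow> ('k, 'g, 'v::ab_group_add) nij_rep \<Rightarrow>
   ('g \<Rightarrow> 'g \<Rightarrow> 'v) \<times> ('g \<Rightarrow> 'v) \<Rightarrow> (('g \<Rightarrow> 'g \<Rightarrow> 'v) \<times> ('g \<Rightarrow> 'v)) set" where
  "cohom_class G V c = {c' \<in> cocycles G V. cohomologous G V c c'}"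

definition H2 ::
  "('k::field, 'g::ab_group_add) nij_lie \<Rightarrow> ('k, 'g, 'v::ab_group_add) nij_rep \<Rightarrow>
   (('g \<Rightarrow> 'g \<Rightarrow> 'v) \<times> ('g \<Rightarrow> 'v)) set set" where
  "H2 G V = cohom_class G V ` cocycles G V"

definition H2_zero ::
  "('k::field, 'g::ab_group_add) nij_lie \<Rightarrow> ('k, 'g, 'v::ab_group_add) nij_rep \<Rightarrow>
   (('g \<Rightarrow> 'g \<Rightarrow> 'v) \<times> ('g \<Rightarrow> 'v)) set" where
  "H2_zero G V = cohom_class G V (\<lambda>x y. 0, \<lambda>x. 0)"

text \<open>The map \<open>i\<close> is not an inclusion: \<open>\<gamma>(V) = V\<close> reads \<open>\<gamma> ` range i = range i\<close>, and the elements
  of \<open>V\<close> given by formulas in \<open>E\<close>, such as \<open>[s x, s y] - s [x, y]\<close>, are pulled back along \<open>i\<close>.\<close>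

definition aut_V ::
  "('k::field, 'e::ab_group_add) nij_lie \<Rightarrow> ('v \<Rightarrow> 'e) \<Rightarrow> ('e \<Rightarrow> 'e) monoid" where
  "aut_V E i = (nij_aut E)\<lparr>carrier := {\<gamma> \<in> carrier (nij_aut E). \<gamma> ` range i = range i}\<rparr>"

definition section_cocycle ::
  "('k::field, 'g::ab_group_add) nij_lie \<Rightarrow> ('k, 'e::ab_group_add) nij_lie \<Rightarrow>
   ('v::ab_group_add \<Rightarrow> 'e) \<Rightarrow> ('g \<Rightarrow> 'e) \<Rightarrow> ('g \<Rightarrow> 'g \<Rightarrow> 'v) \<times> ('g \<Rightarrow> 'v)" where
  "section_cocycle G E i s =
     (\<lambda>x y. inv_into UNIV i (brk E (s x) (s y) - s (brk G x y)),
      \<lambda>x. inv_into UNIV i (nij E (s x) - s (nij G x)))"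

text \<open>An arbitrary choice of section. Sections exist, and the maps \<open>tau\<close> and \<open>wells\<close> built from this
  one do not depend on the choice: see \<open>ex_section\<close>, \<open>tau_eq\<close> and \<open>wells_eq\<close> below.\<close>

definition the_section ::
  "('k::field, 'g::ab_group_add) nij_lie \<Rightarrow> ('k, 'e::ab_group_add) nij_lie \<Rightarrow>
   ('e \<Rightarrow> 'g) \<Rightarrow> 'g \<Rightarrow> 'e" where
  "the_section G E p = (SOME s. is_section G E p s)"

definition tau ::
  "('k::field, 'g::ab_group_add) nij_lie \<Rightarrow> ('k, 'e::ab_group_add) nij_lie \<Rightarrow>
   ('v::ab_group_add \<Rightarrow> 'e) \<Rightarrow> ('e \<Rightarrow> 'g) \<Rightarrow> ('e \<Rightarrow> 'e) \<Rightarrow> ('v \<Rightarrow> 'v) \<times> ('g \<Rightarrow> 'g)" where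
  "tau G E i p \<gamma> = (inv_into UNIV i \<circ> \<gamma> \<circ> i, p \<circ> \<gamma> \<circ> the_section G E p)"

definition inducible ::
  "('k::field, 'g::ab_group_add) nij_lie \<Rightarrow> ('k, 'e::ab_group_add) nij_lie \<Rightarrow>
   ('v::ab_group_add \<Rightarrow> 'e) \<Rightarrow> ('e \<Rightarrow> 'g) \<Rightarrow> ('v \<Rightarrow> 'v) \<times> ('g \<Rightarrow> 'g) \<Rightarrow> bool" where
  "inducible G E i p c \<longleftrightarrow> (\<exists>\<gamma> \<in> carrier (aut_V E i). c = tau G E i p \<gamma>)"

definition aut_V_g ::
  "('k::field, 'g::ab_group_add) nij_lie \<Rightarrow> ('k, 'e::ab_group_add) nij_lie \<Rightarrow>
   ('v::ab_group_add \<Rightarrow> 'e) \<Rightarrow> ('e \<Rightarrow> 'g) \<Rightarrow> ('e \<Rightarrow> 'e) monoid" where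
  "aut_V_g G E i p =
     (aut_V E i)\<lparr>carrier := {\<gamma> \<in> carrier (aut_V E i). tau G E i p \<gamma> = (id, id)}\<rparr>"

definition C_rho ::
  "('k::field, 'g::ab_group_add) nij_lie \<Rightarrow> ('k, 'g, 'v::ab_group_add) nij_rep \<Rightarrow>
   (('v \<Rightarrow> 'v) \<times> ('g \<Rightarrow> 'g)) monoid" where
  "C_rho G V = (nij_aut (zero_bracket V) \<times>\<times> nij_aut G)\<lparr>carrier :=
     {(\<beta>, \<alpha>) \<in> carrier (nij_aut (zero_bracket V)) \<times> carrier (nij_aut G).
        \<forall>x v. \<beta> (act V x v) = act V (\<alpha> x) (\<beta> v)}\<rparr>"

definition wells_of_cocycle ::
  "('k::field, 'g::ab_group_add) nij_lie \<Rightarrow> ('k, 'g, 'v::ab_group_add) nij_rep \<Rightarrow>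
   ('g \<Rightarrow> 'g \<Rightarrow> 'v) \<times> ('g \<Rightarrow> 'v) \<Rightarrow>
   ('v \<Rightarrow> 'v) \<times> ('g \<Rightarrow> 'g) \<Rightarrow> (('g \<Rightarrow> 'g \<Rightarrow> 'v) \<times> ('g \<Rightarrow> 'v)) set" where
  "wells_of_cocycle G V = (\<lambda>(\<chi>, F) (\<beta>, \<alpha>). cohom_class G V
     (\<lambda>x y. \<beta> (\<chi> (inv_into UNIV \<alpha> x) (inv_into UNIV \<alpha> y)) - \<chi> x y,
      \<lambda>x. \<beta> (F (inv_into UNIV \<alpha> x)) - F x))"

definition wells ::
  "('k::field, 'g::ab_group_add) nij_lie \<Rightarrow> ('k, 'g, 'v::ab_group_add) nij_rep \<Rightarrow>
   ('k, 'e::ab_group_add) nij_lie \<Rightarrow> ('v \<Rightarrow> 'e) \<Rightarrow> ('e \<Rightarrow> 'g) \<Rightarrow>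
   ('v \<Rightarrow> 'v) \<times> ('g \<Rightarrow> 'g) \<Rightarrow> (('g \<Rightarrow> 'g \<Rightarrow> 'v) \<times> ('g \<Rightarrow> 'v)) set" where
  "wells G V E i p = wells_of_cocycle G V (section_cocycle G E i (the_section G E p))"

lemma ex_section:
  assumes "abelian_extension G V E i p"
  shows "\<exists>s. is_section G E p s"
proof -
  have l: "Vector_Spaces.linear (scl E) (scl G) p" and "surj p"
    using assms by (auto simp: abelian_extension_def nij_hom_def)
  interpret l: Vector_Spaces.linear "scl E" "scl G" p by (rule l)
  interpret vector_space_pair "scl E" "scl G" ..
  show ?thesis
    using linear_surjective_right_inverse[OF l \<open>surj p\<close>] by (auto simp: is_section_def)
qed

lemma the_section:
  "abelian_extension G V E i p \<Longrightarrow> is_section G E p (the_section G E p)"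
  unfolding the_section_def by (rule someI_ex[OF ex_section])

lemma section_diff:
  assumes ext: "abelian_extension G V E i p"
    and s: "is_section G E p s" and s': "is_section G E p s'"
  obtains \<phi> where "Vector_Spaces.linear (scl G) (rscl V) \<phi>" "\<And>x. s x = s' x + i (\<phi> x)"
proof -
  have lp: "Vector_Spaces.linear (scl E) (scl G) p"
    and li: "Vector_Spaces.linear (rscl V) (scl E) i"
    and ls: "Vector_Spaces.linear (scl G) (scl E) s"
    and ls': "Vector_Spaces.linear (scl G) (scl E) s'"
    and "inj i" and ri: "range i = {e. p e = 0}"
    and ps: "\<And>x. p (s x) = x" "\<And>x. p (s' x) = x"
    using ext s s'
    by (auto simp: abelian_extension_def nij_hom_def is_section_def zero_bracket_def fun_eq_iff)
  interpret p: Vector_Spaces.linear "scl E" "scl G" p by (rule lp)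
  interpret i: Vector_Spaces.linear "rscl V" "scl E" i by (rule li)
  interpret s: Vector_Spaces.linear "scl G" "scl E" s by (rule ls)
  interpret s': Vector_Spaces.linear "scl G" "scl E" s' by (rule ls')
  define \<phi> where "\<phi> x = inv_into UNIV i (s x - s' x)" for x
  have "s x - s' x \<in> range i" for x
    by (simp add: ri p.diff ps)
  then have phi: "i (\<phi> x) = s x - s' x" for x
    unfolding \<phi>_def by (rule f_inv_into_f)
  have "\<phi> (x + y) = \<phi> x + \<phi> y" for x y
    by (rule injD[OF \<open>inj i\<close>]) (simp add: phi i.add s.add s'.add)
  moreover have "\<phi> (scl G r x) = rscl V r (\<phi> x)" for r x
    by (rule injD[OF \<open>inj i\<close>])
      (simp add: phi i.scale s.scale s'.scale p.vs1.scale_right_diff_distrib)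
  ultimately have "Vector_Spaces.linear (scl G) (rscl V) \<phi>"
    by unfold_locales
  then show ?thesis
    using that phi by simp
qed

lemma tau_eq:
  assumes ext: "abelian_extension G V E i p" and \<gamma>: "\<gamma> \<in> carrier (aut_V E i)"
    and s: "is_section G E p s"
  shows "tau G E i p \<gamma> = (inv_into UNIV i \<circ> \<gamma> \<circ> i, p \<circ> \<gamma> \<circ> s)"
proof -
  obtain \<phi> where phi: "\<And>x. the_section G E p x = s x + i (\<phi> x)"
    using section_diff[OF ext the_section[OF ext] s] by blast
  have lp: "Vector_Spaces.linear (scl E) (scl G) p" and ri: "range i = {e. p e = 0}"
    using ext by (auto simp: abelian_extension_def nij_hom_def)
  have lg: "Vector_Spaces.linear (scl E) (scl E) \<gamma>" and gi: "\<gamma> ` range i = range i"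
    using \<gamma> by (auto simp: aut_V_def nij_aut_def nij_hom_def)
  interpret p: Vector_Spaces.linear "scl E" "scl G" p by (rule lp)
  interpret g: Vector_Spaces.linear "scl E" "scl E" \<gamma> by (rule lg)
  have "p (\<gamma> (i v)) = 0" for v
    using gi ri by blast
  then show ?thesis
    by (simp add: tau_def fun_eq_iff phi g.add p.add)
qed

lemma bilinear_map_add:
  assumes "bilinear_map s1 s2 s3 f"
  shows "f (x + x') y = f x y + f x' y" "f x (y + y') = f x y + f x y'"
proof -
  interpret l: Vector_Spaces.linear s1 s3 "\<lambda>x. f x y"
    using assms by (simp add: bilinear_map_def)
  interpret r: Vector_Spaces.linear s2 s3 "f x"
    using assms by (simp add: bilinear_map_def)
  show "f (x + x') y = f x y + f x' y" "f x (y + y') = f x y + f x y'"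
    by (rule l.add, rule r.add)
qed

lemma bilinear_map_diff:
  assumes "bilinear_map s1 s2 s3 f"
  shows "f x (y - y') = f x y - f x y'"
  using bilinear_map_add(2)[OF assms, of x "y - y'" y'] by (simp add: algebra_simps)

lemma linear_comp_diff:
  assumes b: "Vector_Spaces.linear s2 s2 b" and f: "Vector_Spaces.linear s1 s2 f"
    and a: "Vector_Spaces.linear s1 s1 a"
  shows "Vector_Spaces.linear s1 s2 (\<lambda>x. b (f (a x)) - f x)"
proof -
  interpret b: Vector_Spaces.linear s2 s2 b by (rule b)
  interpret f: Vector_Spaces.linear s1 s2 f by (rule f)
  interpret a: Vector_Spaces.linear s1 s1 a by (rule a)
  show ?thesis
    by unfold_locales
      (simp_all add: a.add f.add b.add a.scale f.scale b.scale b.vs1.scale_right_diff_distrib)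
qed

lemma cohom_class_eq:
  assumes G: "nijenhuis_lie_algebra G" and V: "nijenhuis_representation G V"
    and c: "cohomologous G V c c'"
  shows "cohom_class G V c = cohom_class G V c'"
proof -
  obtain \<chi> F \<chi>' F' where eqs: "c = (\<chi>, F)" "c' = (\<chi>', F')"
    by (cases c, cases c')
  obtain \<phi> where l: "Vector_Spaces.linear (scl G) (rscl V) \<phi>"
    and X: "\<And>x y. \<chi> x y - \<chi>' x y = act V x (\<phi> y) - act V y (\<phi> x) - \<phi> (brk G x y)"
    and F: "\<And>x. F x - F' x = rnij V (\<phi> x) - \<phi> (nij G x)"
    using c by (auto simp: cohomologous_def eqs)
  have bl: "bilinear_map (scl G) (rscl V) (rscl V) (act V)"
    and lS: "Vector_Spaces.linear (rscl V) (rscl V) (rnij V)"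
    using V by (auto simp: nijenhuis_representation_def)
  interpret S: Vector_Spaces.linear "rscl V" "rscl V" "rnij V" by (rule lS)
  interpret f: Vector_Spaces.linear "scl G" "rscl V" \<phi> by (rule l)
  have "cohomologous G V c d \<longleftrightarrow> cohomologous G V c' d" for d
  proof -
    obtain \<eta> K where d: "d = (\<eta>, K)" by (cases d)
    show ?thesis
    proof
      assume "cohomologous G V c d"
      then obtain \<psi> where l': "Vector_Spaces.linear (scl G) (rscl V) \<psi>"
        and X': "\<And>x y. \<chi> x y - \<eta> x y = act V x (\<psi> y) - act V y (\<psi> x) - \<psi> (brk G x y)"
        and F': "\<And>x. F x - K x = rnij V (\<psi> x) - \<psi> (nij G x)"
        by (auto simp: cohomologous_def eqs d)
      interpret g: Vector_Spaces.linear "scl G" "rscl V" \<psi> by (rule l')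
      have "Vector_Spaces.linear (scl G) (rscl V) (\<lambda>x. \<psi> x - \<phi> x)"
        by unfold_locales (simp_all add: f.add g.add f.scale g.scale S.vs1.scale_right_diff_distrib)
      moreover have "\<chi>' x y - \<eta> x y = act V x (\<psi> y - \<phi> y) - act V y (\<psi> x - \<phi> x)
          - (\<psi> (brk G x y) - \<phi> (brk G x y))" for x y
        proof -
          have "\<chi>' x y - \<eta> x y = (\<chi> x y - \<eta> x y) - (\<chi> x y - \<chi>' x y)" by simp
          then show ?thesis
            unfolding X X' bilinear_map_diff[OF bl] by (simp add: algebra_simps)
        qed
      moreover have "F' x - K x = rnij V (\<psi> x - \<phi> x) - (\<psi> (nij G x) - \<phi> (nij G x))" for x
        proof -
          have "F' x - K x = (F x - K x) - (F x - F' x)" by simp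
          then show ?thesis
            unfolding F F' S.diff by (simp add: algebra_simps)
        qed
      ultimately show "cohomologous G V c' d"
        unfolding cohomologous_def eqs d by blast
    next
      assume "cohomologous G V c' d"
      then obtain \<psi> where l': "Vector_Spaces.linear (scl G) (rscl V) \<psi>"
        and X': "\<And>x y. \<chi>' x y - \<eta> x y = act V x (\<psi> y) - act V y (\<psi> x) - \<psi> (brk G x y)"
        and F': "\<And>x. F' x - K x = rnij V (\<psi> x) - \<psi> (nij G x)"
        by (auto simp: cohomologous_def eqs d)
      interpret g: Vector_Spaces.linear "scl G" "rscl V" \<psi> by (rule l')
      have "Vector_Spaces.linear (scl G) (rscl V) (\<lambda>x. \<psi> x + \<phi> x)"
        by unfold_locales (simp_all add: f.add g.add f.scale g.scale S.vs1.scale_right_distrib)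
      moreover have "\<chi> x y - \<eta> x y = act V x (\<psi> y + \<phi> y) - act V y (\<psi> x + \<phi> x)
          - (\<psi> (brk G x y) + \<phi> (brk G x y))" for x y
        proof -
          have "\<chi> x y - \<eta> x y = (\<chi> x y - \<chi>' x y) + (\<chi>' x y - \<eta> x y)" by simp
          then show ?thesis
            unfolding X X' bilinear_map_add[OF bl] by (simp add: algebra_simps)
        qed
      moreover have "F x - K x = rnij V (\<psi> x + \<phi> x) - (\<psi> (nij G x) + \<phi> (nij G x))" for x
        proof -
          have "F x - K x = (F x - F' x) + (F' x - K x)" by simp
          then show ?thesis
            unfolding F F' S.add by (simp add: algebra_simps)
        qed
      ultimately show "cohomologous G V c d"
        unfolding cohomologous_def eqs d by blast
    qed
  qed
  then show ?thesis
    by (simp add: cohom_class_def)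
qed

lemma section_cocycle_cohomologous:
  assumes ext: "abelian_extension G V E i p"
    and s: "is_section G E p s" and s': "is_section G E p s'"
  shows "cohomologous G V (section_cocycle G E i s) (section_cocycle G E i s')"
proof -
  obtain \<phi> where lphi: "Vector_Spaces.linear (scl G) (rscl V) \<phi>"
    and phi: "\<And>x. s x = s' x + i (\<phi> x)"
    using section_diff[OF ext s s'] by blast
  have li: "Vector_Spaces.linear (rscl V) (scl E) i" and "inj i"
    and lp: "Vector_Spaces.linear (scl E) (scl G) p"
    and ri: "range i = {e. p e = 0}"
    and lU: "Vector_Spaces.linear (scl E) (scl E) (nij E)"
    and bE: "bilinear_map (scl E) (scl E) (scl E) (brk E)"
    and ex: "\<And>x. brk E x x = 0"
    and ii: "\<And>u v. brk E (i u) (i v) = i 0"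
    and iS: "\<And>v. i (rnij V v) = nij E (i v)"
    and pb: "\<And>u v. p (brk E u v) = brk G (p u) (p v)"
    and pN: "\<And>u. p (nij E u) = nij G (p u)"
    and ps: "\<And>x. p (s x) = x" "\<And>x. p (s' x) = x"
    using ext s s'
    by (auto simp: abelian_extension_def nijenhuis_lie_algebra_def nij_hom_def is_section_def
        zero_bracket_def fun_eq_iff)
  interpret i: Vector_Spaces.linear "rscl V" "scl E" i by (rule li)
  interpret p: Vector_Spaces.linear "scl E" "scl G" p by (rule lp)
  interpret U: Vector_Spaces.linear "scl E" "scl E" "nij E" by (rule lU)
  have rho: "i (act V x v) = brk E (s' x) (i v)" for x v
    using ext s' by (simp add: abelian_extension_def)
  have "brk E x y + brk E y x = 0" for x y
    using ex[of "x + y"] unfolding bilinear_map_add[OF bE] by (simp add: ex add.commute)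
  then have anti: "brk E x y = - brk E y x" for x y
    by (rule eq_neg_iff_add_eq_0[THEN iffD2])
  have X: "i (inv_into UNIV i (brk E (t x) (t y) - t (brk G x y)))
      = brk E (t x) (t y) - t (brk G x y)" if "\<And>x. p (t x) = x" for t x y
    by (rule f_inv_into_f) (simp add: ri p.diff pb that)
  have F: "i (inv_into UNIV i (nij E (t x) - t (nij G x))) = nij E (t x) - t (nij G x)"
    if "\<And>x. p (t x) = x" for t x
    by (rule f_inv_into_f) (simp add: ri p.diff pN that)
  have "inv_into UNIV i (brk E (s x) (s y) - s (brk G x y))
      - inv_into UNIV i (brk E (s' x) (s' y) - s' (brk G x y))
      = act V x (\<phi> y) - act V y (\<phi> x) - \<phi> (brk G x y)" for x y
    apply (rule injD[OF \<open>inj i\<close>])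
    unfolding i.diff X[OF ps(1)] X[OF ps(2)] rho
    using anti[of "s' y" "i (\<phi> x)"] by (simp add: phi bilinear_map_add[OF bE] ii i.zero)
  moreover have "inv_into UNIV i (nij E (s x) - s (nij G x))
      - inv_into UNIV i (nij E (s' x) - s' (nij G x)) = rnij V (\<phi> x) - \<phi> (nij G x)" for x
    apply (rule injD[OF \<open>inj i\<close>])
    unfolding i.diff F[OF ps(1)] F[OF ps(2)] iS
    by (simp add: phi U.add)
  ultimately show ?thesis
    using lphi unfolding cohomologous_def section_cocycle_def by auto
qed

lemma wells_eq:
  assumes ext: "abelian_extension G V E i p" and c: "(\<beta>, \<alpha>) \<in> carrier (C_rho G V)"
    and s: "is_section G E p s"
  shows "wells G V E i p (\<beta>, \<alpha>) = wells_of_cocycle G V (section_cocycle G E i s) (\<beta>, \<alpha>)"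
proof -
  let ?a = "inv_into UNIV \<alpha>"
  obtain \<chi> F \<chi>' F' where eqs: "section_cocycle G E i (the_section G E p) = (\<chi>, F)"
    "section_cocycle G E i s = (\<chi>', F')"
    by (meson surj_pair)
  obtain \<phi> where l: "Vector_Spaces.linear (scl G) (rscl V) \<phi>"
    and X: "\<And>x y. \<chi> x y - \<chi>' x y = act V x (\<phi> y) - act V y (\<phi> x) - \<phi> (brk G x y)"
    and F: "\<And>x. F x - F' x = rnij V (\<phi> x) - \<phi> (nij G x)"
    using section_cocycle_cohomologous[OF ext the_section[OF ext] s]
    by (auto simp: cohomologous_def eqs)
  have G: "nijenhuis_lie_algebra G" and V: "nijenhuis_representation G V"
    using ext by (auto simp: abelian_extension_def)
  then have bl: "bilinear_map (scl G) (rscl V) (rscl V) (act V)"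
    and lS: "Vector_Spaces.linear (rscl V) (rscl V) (rnij V)"
    by (auto simp: nijenhuis_representation_def)
  have lb: "Vector_Spaces.linear (rscl V) (rscl V) \<beta>" and bS: "\<And>v. \<beta> (rnij V v) = rnij V (\<beta> v)"
    and la: "Vector_Spaces.linear (scl G) (scl G) \<alpha>" and aN: "\<And>x. \<alpha> (nij G x) = nij G (\<alpha> x)"
    and ab: "\<And>x y. \<alpha> (brk G x y) = brk G (\<alpha> x) (\<alpha> y)" and "bij \<alpha>"
    and comp: "\<And>x v. \<beta> (act V x v) = act V (\<alpha> x) (\<beta> v)"
    using c by (auto simp: C_rho_def nij_aut_def nij_hom_def zero_bracket_def)
  have aa [simp]: "\<alpha> (?a x) = x" for x
    using \<open>bij \<alpha>\<close> by (simp add: bij_is_surj surj_f_inv_f)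
  have ia: "inj \<alpha>" using \<open>bij \<alpha>\<close> by (rule bij_is_inj)
  interpret b: Vector_Spaces.linear "rscl V" "rscl V" \<beta> by (rule lb)
  interpret a: Vector_Spaces.linear "scl G" "scl G" \<alpha> by (rule la)
  interpret S: Vector_Spaces.linear "rscl V" "rscl V" "rnij V" by (rule lS)
  have la': "Vector_Spaces.linear (scl G) (scl G) ?a"
    by unfold_locales (rule injD[OF ia], simp add: a.add a.scale)+
  have ab': "?a (brk G x y) = brk G (?a x) (?a y)" for x y
    by (rule injD[OF ia]) (simp add: ab)
  have aN': "?a (nij G x) = nij G (?a x)" for x
    by (rule injD[OF ia]) (simp add: aN)
  have bX: "\<beta> (\<chi> (?a x) (?a y)) - \<beta> (\<chi>' (?a x) (?a y))
     = act V x (\<beta> (\<phi> (?a y))) - act V y (\<beta> (\<phi> (?a x))) - \<beta> (\<phi> (?a (brk G x y)))" for x y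
    unfolding b.diff[symmetric] X by (simp add: b.diff comp ab')
  have bF: "\<beta> (F (?a x)) - \<beta> (F' (?a x)) = rnij V (\<beta> (\<phi> (?a x))) - \<beta> (\<phi> (?a (nij G x)))" for x
    unfolding b.diff[symmetric] F by (simp add: b.diff bS aN')
  let ?p = "\<lambda>x. \<beta> (\<phi> (?a x)) - \<phi> x"
  have "(\<beta> (\<chi> (?a x) (?a y)) - \<chi> x y) - (\<beta> (\<chi>' (?a x) (?a y)) - \<chi>' x y)
      = act V x (?p y) - act V y (?p x) - ?p (brk G x y)" for x y
    proof -
          have "(\<beta> (\<chi> (?a x) (?a y)) - \<chi> x y) - (\<beta> (\<chi>' (?a x) (?a y)) - \<chi>' x y)
            = (\<beta> (\<chi> (?a x) (?a y)) - \<beta> (\<chi>' (?a x) (?a y))) - (\<chi> x y - \<chi>' x y)" by simp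
          then show ?thesis
            unfolding bX X bilinear_map_diff[OF bl] by (simp add: algebra_simps)
        qed
  moreover have "(\<beta> (F (?a x)) - F x) - (\<beta> (F' (?a x)) - F' x)
      = rnij V (?p x) - ?p (nij G x)" for x
    proof -
          have "(\<beta> (F (?a x)) - F x) - (\<beta> (F' (?a x)) - F' x)
            = (\<beta> (F (?a x)) - \<beta> (F' (?a x))) - (F x - F' x)" by simp
          then show ?thesis
            unfolding bF F S.diff by (simp add: algebra_simps)
        qed
  moreover have "Vector_Spaces.linear (scl G) (rscl V) ?p"
    by (rule linear_comp_diff[OF lb l la'])
  ultimately show ?thesis
    unfolding wells_def wells_of_cocycle_def eqs prod.case
    by (intro cohom_class_eq[OF G V])
      (unfold cohomologous_def prod.case, blast)
qed

end

theory Submission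
  imports Defs
begin

text \<open>
  Fix a section \<open>s\<close> and let \<open>(\<chi>, F)\<close> be its cocycle. Every element of \<open>E\<close> is \<open>s x + i u\<close> for
  unique \<open>x\<close> and \<open>u\<close>, and in these coordinates the structure of \<open>E\<close> reads

    \<open>[s x + i u, s y + i v] = s [x, y] + i (\<chi>(x, y) + \<rho>\<^sub>x v - \<rho>\<^sub>y u)\<close>,
    \<open>U (s x + i u) = s (N x) + i (F x + S u)\<close>

  (lemmas \<open>brk_coords\<close> and \<open>nij_coords\<close>). An automorphism \<open>\<gamma>\<close> that preserves \<open>V\<close> induces
  \<open>(\<beta>, \<alpha>)\<close> exactly when it has the form

    \<open>\<gamma> (s x + i u) = s (\<alpha> x) + i (\<psi> x + \<beta> u)\<close>

  for some linear \<open>\<psi>: \<gg> \<rightarrow> V\<close>. Comparing the two displays, such a map respects the bracket and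
  the Nijenhuis operator if and only if \<open>(\<beta>, \<alpha>)\<close> is compatible with the representation and

    \<open>\<beta> \<chi>(x, y) + \<psi> [x, y] = \<chi>(\<alpha> x, \<alpha> y) + \<rho>\<^bsub>\<alpha> x\<^esub> (\<psi> y) - \<rho>\<^bsub>\<alpha> y\<^esub> (\<psi> x)\<close>,
    \<open>\<beta> (F x) + \<psi> (N x) = F (\<alpha> x) + S (\<psi> x)\<close>.

  After the substitution \<open>\<phi> = \<psi> \<circ> \<alpha>\<^sup>-\<^sup>1\<close> these two equations say that \<open>\<phi>\<close> bounds the difference
  of the transported cocycle and \<open>(\<chi>, F)\<close>, that is, that the Wells class of \<open>(\<beta>, \<alpha>)\<close> vanishes
  (\<open>wells_of_cocycle_eq_zero_iff\<close>). This identifies the image of \<open>\<tau>\<close> (\<open>image_tau_iff\<close>), which is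
  both part (i) and exactness at \<open>\<C>\<^sub>\<rho>\<close>. The rest of the sequence is formal once \<open>\<tau>\<close> is known to
  be a homomorphism, because \<open>Aut\<^bsub>V,\<gg>\<^esub>\<close> is by definition its kernel, and once the Wells map is
  known to land in cohomology, because cocycles are closed under transport and difference.
\<close>

section \<open>Linear and bilinear maps\<close>

text \<open>Unfolded in this way, bilinearity can be checked after applying an injective linear map.\<close>

lemma bilinear_map_iff:
  "bilinear_map s1 s2 s3 f \<longleftrightarrow> vector_space s1 \<and> vector_space s2 \<and> vector_space s3 \<and>
     (\<forall>x x' y. f (x + x') y = f x y + f x' y) \<and> (\<forall>x y y'. f x (y + y') = f x y + f x y') \<and>
     (\<forall>r x y. f (s1 r x) y = s3 r (f x y)) \<and> (\<forall>r x y. f x (s2 r y) = s3 r (f x y))"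
  unfolding bilinear_map_def Vector_Spaces.linear_iff by blast

lemma bilinear_map_scale:
  assumes "bilinear_map s1 s2 s3 f"
  shows "f (s1 r x) y = s3 r (f x y)" "f x (s2 r y) = s3 r (f x y)"
  using assms by (auto simp: bilinear_map_iff)

lemma bilinear_map_zero:
  assumes "bilinear_map s1 s2 s3 f"
  shows "f x 0 = 0"
  using bilinear_map_add(2)[OF assms, of x 0 0] by simp

lemma alternating_imp_skew:
  assumes "bilinear_map s1 s1 s3 f" and "\<And>x. f x x = 0"
  shows "f x y = - f y x"
  using assms(2)[of "x + y"] unfolding bilinear_map_add[OF assms(1)]
  by (simp add: assms(2) eq_neg_iff_add_eq_0 add.commute)

lemma linear_inv_into:
  assumes l: "Vector_Spaces.linear s1 s2 f" and "bij f"
  shows "Vector_Spaces.linear s2 s1 (inv_into UNIV f)"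
proof -
  have inv: "f (inv_into UNIV f y) = y" for y
    using \<open>bij f\<close> by (simp add: bij_is_surj surj_f_inv_f)
  have inj: "f x = f y \<Longrightarrow> x = y" for x y
    using \<open>bij f\<close> by (meson bij_is_inj injD)
  show ?thesis
    using l unfolding Vector_Spaces.linear_iff by (auto intro!: inj simp: inv)
qed

section \<open>Groups of Nijenhuis automorphisms\<close>

lemma nij_aut_simps [simp]:
  "carrier (nij_aut G) = {f. nij_hom G G f \<and> bij f}"
  "\<one>\<^bsub>nij_aut G\<^esub> = id"
  "f \<otimes>\<^bsub>nij_aut G\<^esub> g = f \<circ> g"
  by (simp_all add: nij_aut_def)

lemma nij_hom_comp:
  assumes "nij_hom G H f" "nij_hom H K g"
  shows "nij_hom G K (g \<circ> f)"
  using assms by (auto simp: nij_hom_def Vector_Spaces.linear_iff)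

lemma nij_hom_id: "vector_space (scl G) \<Longrightarrow> nij_hom G G id"
  by (auto simp: nij_hom_def Vector_Spaces.linear_iff)

lemma nij_hom_inv_into:
  assumes f: "nij_hom G H f" and "bij f"
  shows "nij_hom H G (inv_into UNIV f)"
proof -
  have inv: "f (inv_into UNIV f y) = y" for y
    using \<open>bij f\<close> by (simp add: bij_is_surj surj_f_inv_f)
  have inj: "f x = f y \<Longrightarrow> x = y" for x y
    using \<open>bij f\<close> by (meson bij_is_inj injD)
  show ?thesis
    using f linear_inv_into[OF _ \<open>bij f\<close>]
    unfolding nij_hom_def by (auto intro!: inj simp: inv)
qed

lemma group_nij_aut:
  assumes "vector_space (scl G)"
  shows "group (nij_aut G)"
proof (rule groupI)
  fix f assume "f \<in> carrier (nij_aut G)"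
  then have f: "nij_hom G G f" "bij f" by auto
  show "\<exists>g \<in> carrier (nij_aut G). g \<otimes>\<^bsub>nij_aut G\<^esub> f = \<one>\<^bsub>nij_aut G\<^esub>"
    by (rule bexI[of _ "inv_into UNIV f"])
      (use f in \<open>simp_all add: nij_hom_inv_into bij_imp_bij_inv bij_is_inj\<close>)
qed (auto simp: assms nij_hom_id intro: nij_hom_comp bij_comp)

lemma inv_nij_aut:
  assumes "vector_space (scl G)" "f \<in> carrier (nij_aut G)"
  shows "inv\<^bsub>nij_aut G\<^esub> f = inv_into UNIV f"
proof -
  interpret group "nij_aut G" by (rule group_nij_aut[OF assms(1)])
  show ?thesis
    by (rule inv_equality)
      (use assms in \<open>simp_all add: nij_hom_inv_into bij_imp_bij_inv bij_is_inj\<close>)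
qed

lemma aut_V_simps [simp]:
  "carrier (aut_V E i) = {\<gamma>. nij_hom E E \<gamma> \<and> bij \<gamma> \<and> \<gamma> ` range i = range i}"
  "\<one>\<^bsub>aut_V E i\<^esub> = id"
  "f \<otimes>\<^bsub>aut_V E i\<^esub> g = f \<circ> g"
  by (auto simp: aut_V_def nij_aut_def)

lemma group_aut_V:
  assumes "vector_space (scl E)"
  shows "group (aut_V E i)"
  unfolding aut_V_def
proof (rule group.subgroup_imp_group[OF group_nij_aut[OF assms]])
  show "subgroup {\<gamma> \<in> carrier (nij_aut E). \<gamma> ` range i = range i} (nij_aut E)"
  proof (rule group.subgroupI[OF group_nij_aut[OF assms]])
    show "{\<gamma> \<in> carrier (nij_aut E). \<gamma> ` range i = range i} \<noteq> {}"
      using nij_hom_id[OF assms] by (auto intro!: exI[of _ id])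
  next
    fix f assume "f \<in> {\<gamma> \<in> carrier (nij_aut E). \<gamma> ` range i = range i}"
    then have f: "f \<in> carrier (nij_aut E)" and im: "f ` range i = range i" by auto
    have "inv_into UNIV f ` (f ` range i) = range i"
      by (rule inv_into_image_cancel) (use f in \<open>auto simp: bij_is_inj\<close>)
    then show "inv\<^bsub>nij_aut E\<^esub> f \<in> {\<gamma> \<in> carrier (nij_aut E). \<gamma> ` range i = range i}"
      using f im by (simp add: inv_nij_aut[OF assms f] nij_hom_inv_into bij_imp_bij_inv)
  next
    fix f g
    assume "f \<in> {\<gamma> \<in> carrier (nij_aut E). \<gamma> ` range i = range i}"
      and "g \<in> {\<gamma> \<in> carrier (nij_aut E). \<gamma> ` range i = range i}"
    moreover from this have "(f \<circ> g) ` range i = range i"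
      unfolding image_comp[symmetric] by simp
    ultimately show "f \<otimes>\<^bsub>nij_aut E\<^esub> g \<in> {\<gamma> \<in> carrier (nij_aut E). \<gamma> ` range i = range i}"
      by (simp add: nij_hom_comp[of E E g E f] bij_comp)
  qed auto
qed

text \<open>The bracket condition reduces to \<open>\<beta> 0 = 0\<close>, which linearity already contains.\<close>

lemma nij_hom_zero_bracket_iff:
  "nij_hom (zero_bracket V) (zero_bracket V) \<beta> \<longleftrightarrow>
     Vector_Spaces.linear (rscl V) (rscl V) \<beta> \<and> (\<forall>v. \<beta> (rnij V v) = rnij V (\<beta> v))"
proof -
  have "\<beta> 0 = 0" if l: "Vector_Spaces.linear (rscl V) (rscl V) \<beta>"
  proof -
    interpret b: Vector_Spaces.linear "rscl V" "rscl V" \<beta> by (rule l)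
    show ?thesis by (rule b.zero)
  qed
  then show ?thesis
    by (auto simp: nij_hom_def zero_bracket_def)
qed

lemma C_rho_simps [simp]:
  "(\<beta>, \<alpha>) \<in> carrier (C_rho G V) \<longleftrightarrow>
     nij_hom (zero_bracket V) (zero_bracket V) \<beta> \<and> bij \<beta> \<and> nij_hom G G \<alpha> \<and> bij \<alpha> \<and>
     (\<forall>x v. \<beta> (act V x v) = act V (\<alpha> x) (\<beta> v))"
  "\<one>\<^bsub>C_rho G V\<^esub> = (id, id)"
  "(\<beta>, \<alpha>) \<otimes>\<^bsub>C_rho G V\<^esub> (\<beta>', \<alpha>') = (\<beta> \<circ> \<beta>', \<alpha> \<circ> \<alpha>')"
  by (auto simp: C_rho_def)

lemma group_C_rho:
  assumes "vector_space (scl G)" "vector_space (rscl V)"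
  shows "group (C_rho G V)"
proof -
  have zV: "vector_space (scl (zero_bracket V))"
    using assms by (simp add: zero_bracket_def)
  let ?D = "nij_aut (zero_bracket V) \<times>\<times> nij_aut G"
  let ?H = "{(\<beta>, \<alpha>) \<in> carrier (nij_aut (zero_bracket V)) \<times> carrier (nij_aut G).
        \<forall>x v. \<beta> (act V x v) = act V (\<alpha> x) (\<beta> v)}"
  have D: "group ?D"
    by (intro DirProd_group group_nij_aut assms zV)
  have "subgroup ?H ?D"
  proof (rule group.subgroupI[OF D])
    show "?H \<noteq> {}"
      using nij_hom_id[OF assms(1)] nij_hom_id[OF zV] by (auto intro!: exI[of _ id])
  next
    fix c assume "c \<in> ?H"
    then obtain \<beta> \<alpha> where c: "c = (\<beta>, \<alpha>)"
      and b: "\<beta> \<in> carrier (nij_aut (zero_bracket V))" and a: "\<alpha> \<in> carrier (nij_aut G)"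
      and comp: "\<And>x v. \<beta> (act V x v) = act V (\<alpha> x) (\<beta> v)"
      by blast
    have "inv_into UNIV \<beta> (act V x v) = act V (inv_into UNIV \<alpha> x) (inv_into UNIV \<beta> v)" for x v
      using a b by (intro inv_f_eq) (auto simp: comp bij_is_inj bij_is_surj surj_f_inv_f)
    then show "inv\<^bsub>?D\<^esub> c \<in> ?H"
      using a b unfolding c
      by (simp add: inv_DirProd[OF group_nij_aut[OF zV] group_nij_aut[OF assms(1)] b a]
          inv_nij_aut[OF zV b] inv_nij_aut[OF assms(1) a] nij_hom_inv_into bij_imp_bij_inv)
  qed (auto intro: nij_hom_comp bij_comp)
  then show ?thesis
    unfolding C_rho_def by (rule group.subgroup_imp_group[OF D])
qed

section \<open>Cocycles\<close>

text \<open>The left-hand sides of the two cocycle conditions. They are linear in \<open>(\<chi>, F)\<close> and natural in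
  \<open>(\<beta>, \<alpha>)\<close>, so having them as functions turns closure of cocycles into an equation between
  values.\<close>

definition lie_differential ::
  "('k::field, 'g::ab_group_add) nij_lie \<Rightarrow> ('k, 'g, 'v::ab_group_add) nij_rep \<Rightarrow>
   ('g \<Rightarrow> 'g \<Rightarrow> 'v) \<Rightarrow> 'g \<Rightarrow> 'g \<Rightarrow> 'g \<Rightarrow> 'v" where
  "lie_differential G V \<chi> x y z =
     act V x (\<chi> y z) + act V y (\<chi> z x) + act V z (\<chi> x y)
        - \<chi> (brk G x y) z - \<chi> (brk G y z) x - \<chi> (brk G z x) y"

definition nij_differential ::
  "('k::field, 'g::ab_group_add) nij_lie \<Rightarrow> ('k, 'g, 'v::ab_group_add) nij_rep \<Rightarrow>
   ('g \<Rightarrow> 'g \<Rightarrow> 'v) \<Rightarrow> ('g \<Rightarrow> 'v) \<Rightarrow> 'g \<Rightarrow> 'g \<Rightarrow> 'v" where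
  "nij_differential G V \<chi> F x y =
     \<chi> (nij G x) (nij G y)
        - rnij V (\<chi> (nij G x) y + \<chi> x (nij G y) - rnij V (\<chi> x y))
        - F (brk G (nij G x) y + brk G x (nij G y) - nij G (brk G x y))
        + act V (nij G x) (F y) - act V (nij G y) (F x)
        - rnij V (act V x (F y) - act V y (F x) - F (brk G x y))"

lemma mem_cocycles_iff:
  "(\<chi>, F) \<in> cocycles G V \<longleftrightarrow>
     bilinear_map (scl G) (scl G) (rscl V) \<chi> \<and> (\<forall>x. \<chi> x x = 0) \<and>
     Vector_Spaces.linear (scl G) (rscl V) F \<and>
     (\<forall>x y z. lie_differential G V \<chi> x y z = 0) \<and> (\<forall>x y. nij_differential G V \<chi> F x y = 0)"
  by (simp add: cocycles_def lie_differential_def nij_differential_def)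

lemma cocycles_diff:
  assumes V: "nijenhuis_representation G V"
    and c: "(\<chi>, F) \<in> cocycles G V" and c': "(\<chi>', F') \<in> cocycles G V"
  shows "(\<lambda>x y. \<chi> x y - \<chi>' x y, \<lambda>x. F x - F' x) \<in> cocycles G V"
proof -
  have bl: "bilinear_map (scl G) (rscl V) (rscl V) (act V)"
    and lS: "Vector_Spaces.linear (rscl V) (rscl V) (rnij V)"
    using V by (auto simp: nijenhuis_representation_def)
  interpret S: Vector_Spaces.linear "rscl V" "rscl V" "rnij V" by (rule lS)
  have "lie_differential G V (\<lambda>x y. \<chi> x y - \<chi>' x y) x y z
      = lie_differential G V \<chi> x y z - lie_differential G V \<chi>' x y z" for x y z
    by (simp add: lie_differential_def bilinear_map_diff[OF bl] algebra_simps)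
  moreover have "nij_differential G V (\<lambda>x y. \<chi> x y - \<chi>' x y) (\<lambda>x. F x - F' x) x y
      = nij_differential G V \<chi> F x y - nij_differential G V \<chi>' F' x y" for x y
    by (simp add: nij_differential_def bilinear_map_diff[OF bl] S.diff S.add algebra_simps)
  ultimately show ?thesis
    using c c' unfolding mem_cocycles_iff
    by (auto simp: bilinear_map_iff Vector_Spaces.linear_iff S.vs1.scale_right_diff_distrib)
qed

text \<open>Compatibility \<open>\<beta> (\<rho>\<^sub>x v) = \<rho>\<^bsub>\<alpha> x\<^esub> (\<beta> v)\<close> lets \<open>\<beta>\<close> be pulled out of every term of the two
  differentials, leaving the differentials of \<open>(\<chi>, F)\<close> at the points moved by \<open>\<alpha>\<^sup>-\<^sup>1\<close>.\<close>

lemma cocycles_transport: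
  assumes V: "nijenhuis_representation G V" and ba: "(\<beta>, \<alpha>) \<in> carrier (C_rho G V)"
    and c: "(\<chi>, F) \<in> cocycles G V"
  shows "(\<lambda>x y. \<beta> (\<chi> (inv_into UNIV \<alpha> x) (inv_into UNIV \<alpha> y)),
    \<lambda>x. \<beta> (F (inv_into UNIV \<alpha> x))) \<in> cocycles G V"
proof -
  let ?a = "inv_into UNIV \<alpha>"
  have lb: "Vector_Spaces.linear (rscl V) (rscl V) \<beta>" and bS: "\<And>v. rnij V (\<beta> v) = \<beta> (rnij V v)"
    and "bij \<alpha>" and comp: "\<And>x v. \<beta> (act V x v) = act V (\<alpha> x) (\<beta> v)"
    and a: "nij_hom G G ?a"
    using ba by (auto simp: nij_hom_zero_bracket_iff
        intro: nij_hom_inv_into)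
  interpret b: Vector_Spaces.linear "rscl V" "rscl V" \<beta> by (rule lb)
  have aa: "\<alpha> (?a x) = x" for x
    using \<open>bij \<alpha>\<close> by (simp add: bij_is_surj surj_f_inv_f)
  interpret a: Vector_Spaces.linear "scl G" "scl G" ?a
    using a by (simp add: nij_hom_def)
  have ab: "?a (brk G x y) = brk G (?a x) (?a y)" and aN: "?a (nij G x) = nij G (?a x)" for x y
    using a by (simp_all add: nij_hom_def)
  have act: "act V x (\<beta> v) = \<beta> (act V (?a x) v)" for x v
    by (simp add: comp aa)
  have "lie_differential G V (\<lambda>x y. \<beta> (\<chi> (?a x) (?a y))) x y z
      = \<beta> (lie_differential G V \<chi> (?a x) (?a y) (?a z))" for x y z
    by (simp add: lie_differential_def act ab b.diff b.add)
  moreover have "nij_differential G V (\<lambda>x y. \<beta> (\<chi> (?a x) (?a y))) (\<lambda>x. \<beta> (F (?a x))) x y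
      = \<beta> (nij_differential G V \<chi> F (?a x) (?a y))" for x y
    unfolding nij_differential_def act
    by (simp add: bS ab aN a.add a.diff flip: b.diff b.add)
  ultimately show ?thesis
    using c unfolding mem_cocycles_iff
    by (auto simp: bilinear_map_iff Vector_Spaces.linear_iff a.add b.add a.scale b.scale b.zero)
qed

lemma zero_mem_cocycles:
  assumes G: "nijenhuis_lie_algebra G" and V: "nijenhuis_representation G V"
  shows "(\<lambda>x y. 0, \<lambda>x. 0) \<in> cocycles G V"
proof -
  have bl: "bilinear_map (scl G) (rscl V) (rscl V) (act V)"
    and lS: "Vector_Spaces.linear (rscl V) (rscl V) (rnij V)" and vs: "vector_space (scl G)"
    using V G by (auto simp: nijenhuis_representation_def nijenhuis_lie_algebra_def)
  interpret S: Vector_Spaces.linear "rscl V" "rscl V" "rnij V" by (rule lS)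
  show ?thesis
    using vs S.vs1.vector_space_axioms
    by (simp add: mem_cocycles_iff bilinear_map_iff Vector_Spaces.linear_iff lie_differential_def
        nij_differential_def bilinear_map_zero[OF bl] S.zero)
qed

text \<open>A class determines its representative up to coboundaries because the class of zero contains
  zero itself.\<close>

lemma cohom_class_eq_zero_iff:
  assumes G: "nijenhuis_lie_algebra G" and V: "nijenhuis_representation G V"
  shows "cohom_class G V c = H2_zero G V \<longleftrightarrow> cohomologous G V c (\<lambda>x y. 0, \<lambda>x. 0)"
proof
  have bl: "bilinear_map (scl G) (rscl V) (rscl V) (act V)"
    and lS: "Vector_Spaces.linear (rscl V) (rscl V) (rnij V)" and vs: "vector_space (scl G)"
    using V G by (auto simp: nijenhuis_representation_def nijenhuis_lie_algebra_def)
  interpret S: Vector_Spaces.linear "rscl V" "rscl V" "rnij V" by (rule lS)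
  have "cohomologous G V (\<lambda>x y. 0, \<lambda>x. 0) (\<lambda>x y. 0, \<lambda>x. 0)"
    unfolding cohomologous_def prod.case
    by (rule exI[of _ "\<lambda>x. 0"])
      (use vs S.vs1.vector_space_axioms in
        \<open>simp add: Vector_Spaces.linear_iff bilinear_map_zero[OF bl] S.zero\<close>)
  then have "(\<lambda>x y. 0, \<lambda>x. 0) \<in> H2_zero G V"
    using zero_mem_cocycles[OF G V] by (simp add: H2_zero_def cohom_class_def)
  moreover assume "cohom_class G V c = H2_zero G V"
  ultimately show "cohomologous G V c (\<lambda>x y. 0, \<lambda>x. 0)"
    unfolding cohom_class_def by blast
next
  assume "cohomologous G V c (\<lambda>x y. 0, \<lambda>x. 0)"
  then show "cohom_class G V c = H2_zero G V"
    unfolding H2_zero_def by (rule cohom_class_eq[OF G V])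
qed

lemma wells_of_cocycle_mem_H2:
  assumes V: "nijenhuis_representation G V" and ba: "(\<beta>, \<alpha>) \<in> carrier (C_rho G V)"
    and c: "(\<chi>, F) \<in> cocycles G V"
  shows "wells_of_cocycle G V (\<chi>, F) (\<beta>, \<alpha>) \<in> H2 G V"
  unfolding wells_of_cocycle_def H2_def prod.case
  by (intro imageI cocycles_diff[OF V cocycles_transport[OF V ba c] c])

text \<open>The cochains \<open>\<phi>\<close> that bound the Wells cocycle and the cochains \<open>\<psi>\<close> below correspond through
  \<open>\<psi> = \<phi> \<circ> \<alpha>\<close>. The form without \<open>\<alpha>\<^sup>-\<^sup>1\<close> is the one that appears when a lift of \<open>(\<beta>, \<alpha>)\<close> is
  required to be a homomorphism.\<close>

lemma wells_of_cocycle_eq_zero_iff: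
  assumes G: "nijenhuis_lie_algebra G" and V: "nijenhuis_representation G V"
    and ba: "(\<beta>, \<alpha>) \<in> carrier (C_rho G V)"
  shows "wells_of_cocycle G V (\<chi>, F) (\<beta>, \<alpha>) = H2_zero G V \<longleftrightarrow>
    (\<exists>\<psi>. Vector_Spaces.linear (scl G) (rscl V) \<psi> \<and>
      (\<forall>x y. \<beta> (\<chi> x y) + \<psi> (brk G x y)
        = \<chi> (\<alpha> x) (\<alpha> y) + act V (\<alpha> x) (\<psi> y) - act V (\<alpha> y) (\<psi> x)) \<and>
      (\<forall>x. \<beta> (F x) + \<psi> (nij G x) = F (\<alpha> x) + rnij V (\<psi> x)))"
    (is "?W \<longleftrightarrow> (\<exists>\<psi>. ?lin \<psi> \<and> ?X \<psi> \<and> ?F \<psi>)")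
proof -
  let ?a = "inv_into UNIV \<alpha>"
  have a: "nij_hom G G \<alpha>" and a': "nij_hom G G ?a" and "bij \<alpha>"
    using ba by (auto intro: nij_hom_inv_into)
  have aa: "\<alpha> (?a x) = x" and a_a: "?a (\<alpha> x) = x" for x
    using \<open>bij \<alpha>\<close> by (simp_all add: bij_is_surj surj_f_inv_f bij_is_inj)
  have lin: "Vector_Spaces.linear (scl G) (scl G) \<alpha>" "Vector_Spaces.linear (scl G) (scl G) ?a"
    using a a' by (simp_all add: nij_hom_def)
  have ab: "\<alpha> (brk G x y) = brk G (\<alpha> x) (\<alpha> y)" "\<alpha> (nij G x) = nij G (\<alpha> x)"
    "?a (brk G x y) = brk G (?a x) (?a y)" "?a (nij G x) = nij G (?a x)" for x y
    using a a' by (simp_all add: nij_hom_def)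
  have "?W \<longleftrightarrow> (\<exists>\<phi>. ?lin \<phi> \<and>
     (\<forall>x y. \<beta> (\<chi> (?a x) (?a y)) - \<chi> x y = act V x (\<phi> y) - act V y (\<phi> x) - \<phi> (brk G x y)) \<and>
     (\<forall>x. \<beta> (F (?a x)) - F x = rnij V (\<phi> x) - \<phi> (nij G x)))"
    unfolding wells_of_cocycle_def prod.case cohom_class_eq_zero_iff[OF G V]
    by (simp add: cohomologous_def)
  also have "\<dots> \<longleftrightarrow> (\<exists>\<psi>. ?lin \<psi> \<and> ?X \<psi> \<and> ?F \<psi>)"
  proof (intro iffI; elim exE conjE)
    fix \<phi>
    assume l: "?lin \<phi>"
      and X: "\<forall>x y. \<beta> (\<chi> (?a x) (?a y)) - \<chi> x y
        = act V x (\<phi> y) - act V y (\<phi> x) - \<phi> (brk G x y)"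
      and F: "\<forall>x. \<beta> (F (?a x)) - F x = rnij V (\<phi> x) - \<phi> (nij G x)"
    have "?lin (\<lambda>x. \<phi> (\<alpha> x))"
      using l lin by (auto simp: Vector_Spaces.linear_iff)
    moreover have "?X (\<lambda>x. \<phi> (\<alpha> x))"
      using X[rule_format, of "\<alpha> x" "\<alpha> y" for x y] by (auto simp: ab a_a algebra_simps)
    moreover have "?F (\<lambda>x. \<phi> (\<alpha> x))"
      using F[rule_format, of "\<alpha> x" for x] by (auto simp: ab a_a algebra_simps)
    ultimately show "\<exists>\<psi>. ?lin \<psi> \<and> ?X \<psi> \<and> ?F \<psi>" by blast
  next
    fix \<psi>
    assume l: "?lin \<psi>" and X: "?X \<psi>" and F: "?F \<psi>"
    have "?lin (\<lambda>x. \<psi> (?a x))"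
      using l lin by (auto simp: Vector_Spaces.linear_iff)
    moreover have "\<beta> (\<chi> (?a x) (?a y)) - \<chi> x y
        = act V x (\<psi> (?a y)) - act V y (\<psi> (?a x)) - \<psi> (?a (brk G x y))" for x y
      using X[rule_format, of "?a x" "?a y"] by (auto simp: ab aa algebra_simps)
    moreover have "\<beta> (F (?a x)) - F x = rnij V (\<psi> (?a x)) - \<psi> (?a (nij G x))" for x
      using F[rule_format, of "?a x"] by (auto simp: ab aa algebra_simps)
    ultimately show "\<exists>\<phi>. ?lin \<phi> \<and>
     (\<forall>x y. \<beta> (\<chi> (?a x) (?a y)) - \<chi> x y = act V x (\<phi> y) - act V y (\<phi> x) - \<phi> (brk G x y)) \<and>
     (\<forall>x. \<beta> (F (?a x)) - F x = rnij V (\<phi> x) - \<phi> (nij G x))"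
      by (intro exI[of _ "\<lambda>x. \<psi> (?a x)"]) blast
  qed
  finally show ?thesis .
qed

section \<open>An abelian extension in the coordinates of a section\<close>

locale split_extension =
  fixes G :: "('k::field, 'g::ab_group_add) nij_lie"
    and V :: "('k, 'g, 'v::ab_group_add) nij_rep"
    and E :: "('k, 'e::ab_group_add) nij_lie"
    and i :: "'v \<Rightarrow> 'e" and p :: "'e \<Rightarrow> 'g" and s :: "'g \<Rightarrow> 'e"
  assumes ext: "abelian_extension G V E i p" and sec: "is_section G E p s"
begin

lemma G: "nijenhuis_lie_algebra G" and V: "nijenhuis_representation G V"
  and E: "nijenhuis_lie_algebra E"
  and lin: "Vector_Spaces.linear (rscl V) (scl E) i" "Vector_Spaces.linear (scl E) (scl G) p"
    "Vector_Spaces.linear (scl G) (scl E) s"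
  and inj_i: "inj i" and range_i: "range i = {e. p e = 0}"
  and p_s [simp]: "p (s x) = x"
  and p_brk: "p (brk E a b) = brk G (p a) (p b)" and p_nij: "p (nij E a) = nij G (p a)"
  and brk_i_i: "brk E (i u) (i v) = i 0" and nij_i: "nij E (i u) = i (rnij V u)"
  and brk_s_i: "brk E (s x) (i u) = i (act V x u)"
  using ext sec
  by (auto simp: abelian_extension_def nij_hom_def is_section_def zero_bracket_def fun_eq_iff)

lemma bil: "bilinear_map (scl E) (scl E) (scl E) (brk E)"
    "bilinear_map (scl G) (scl G) (scl G) (brk G)"
    "bilinear_map (scl G) (rscl V) (rscl V) (act V)"
  and lin_nij: "Vector_Spaces.linear (scl E) (scl E) (nij E)"
    "Vector_Spaces.linear (scl G) (scl G) (nij G)"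
    "Vector_Spaces.linear (rscl V) (rscl V) (rnij V)"
  and vs: "vector_space (scl E)" "vector_space (scl G)" "vector_space (rscl V)"
  and brk_self: "brk E e e = 0" "brk G x x = 0"
  using G V E by (auto simp: nijenhuis_lie_algebra_def nijenhuis_representation_def)

interpretation i: Vector_Spaces.linear "rscl V" "scl E" i by (rule lin)
interpretation p: Vector_Spaces.linear "scl E" "scl G" p by (rule lin)
interpretation s: Vector_Spaces.linear "scl G" "scl E" s by (rule lin)
interpretation U: Vector_Spaces.linear "scl E" "scl E" "nij E" by (rule lin_nij)
interpretation N: Vector_Spaces.linear "scl G" "scl G" "nij G" by (rule lin_nij)
interpretation S: Vector_Spaces.linear "rscl V" "rscl V" "rnij V" by (rule lin_nij)

lemma i_eq_iff: "i u = i v \<longleftrightarrow> u = v"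
  using inj_i by (rule inj_eq)

lemma p_i [simp]: "p (i u) = 0"
  using range_i by blast

lemma i_inv: "p e = 0 \<Longrightarrow> i (inv_into UNIV i e) = e"
  using range_i by (simp add: f_inv_into_f)

text \<open>Together with \<open>coords_eq_iff\<close>, this identifies \<open>E\<close> with \<open>\<gg> \<oplus> V\<close> as a vector space.\<close>

lemma decompose:
  obtains u where "e = s (p e) + i u"
proof -
  have "e - s (p e) \<in> range i"
    by (simp add: range_i p.diff)
  then show ?thesis
    using that by (metis add.commute diff_add_cancel imageE)
qed

lemma coords_eq_iff: "s x + i u = s y + i v \<longleftrightarrow> x = y \<and> u = v"
  by (metis add_0_right add_left_cancel i_eq_iff p.add p_i p_s)

definition \<chi> :: "'g \<Rightarrow> 'g \<Rightarrow> 'v" where "\<chi> = fst (section_cocycle G E i s)"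
definition F :: "'g \<Rightarrow> 'v" where "F = snd (section_cocycle G E i s)"

lemma section_cocycle_eq: "section_cocycle G E i s = (\<chi>, F)"
  by (simp add: \<chi>_def F_def)

lemma i_chi: "i (\<chi> x y) = brk E (s x) (s y) - s (brk G x y)"
  unfolding \<chi>_def section_cocycle_def by (simp add: i_inv p.diff p_brk)

lemma i_F: "i (F x) = nij E (s x) - s (nij G x)"
  unfolding F_def section_cocycle_def by (simp add: i_inv p.diff p_nij)

lemma brk_i_s: "brk E (i u) (s x) = - i (act V x u)"
  using alternating_imp_skew[OF bil(1) brk_self(1)] brk_s_i by metis

lemma brk_coords:
  "brk E (s x + i u) (s y + i v) = s (brk G x y) + i (\<chi> x y + act V x v - act V y u)"
  by (simp add: bilinear_map_add[OF bil(1)] i.add i.diff i_chi brk_i_s brk_s_i brk_i_i i.zero)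

lemma nij_coords: "nij E (s x + i u) = s (nij G x) + i (F x + rnij V u)"
  by (simp add: U.add i.add i_F nij_i)

text \<open>Since \<open>V\<close> is abelian, the bracket with \<open>i v\<close> only sees the image of \<open>e\<close> in \<open>\<gg>\<close>.\<close>

lemma brk_i: "brk E e (i v) = i (act V (p e) v)"
proof -
  obtain u where e: "e = s (p e) + i u" by (rule decompose)
  show ?thesis
    by (subst e) (simp add: bilinear_map_add[OF bil(1)] brk_s_i brk_i_i i.zero)
qed

lemma bilinear_chi: "bilinear_map (scl G) (scl G) (rscl V) \<chi>"
  unfolding bilinear_map_iff i_eq_iff[symmetric]
  using vs
  by (simp add: i.add i.scale i_chi bilinear_map_add[OF bil(1)] bilinear_map_add[OF bil(2)]
      bilinear_map_scale[OF bil(1)] bilinear_map_scale[OF bil(2)] s.add s.scale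
      i.vs2.scale_right_diff_distrib)

lemma chi_self: "\<chi> x x = 0"
  unfolding i_eq_iff[symmetric] by (simp add: i_chi brk_self s.zero i.zero)

lemma linear_F: "Vector_Spaces.linear (scl G) (rscl V) F"
  unfolding Vector_Spaces.linear_iff i_eq_iff[symmetric]
  using vs
  by (simp add: i.add i.scale i_F U.add U.scale N.add N.scale s.add s.scale
      i.vs2.scale_right_diff_distrib)

text \<open>The Jacobi identity and the Nijenhuis identity of \<open>E\<close>, evaluated on elements \<open>s x\<close>, have the
  corresponding identity of \<open>G\<close> as their \<open>\<gg>\<close>-component and the cocycle condition as their
  \<open>V\<close>-component.\<close>

lemma cocycle: "(\<chi>, F) \<in> cocycles G V"
  unfolding mem_cocycles_iff
proof (intro conjI allI bilinear_chi chi_self linear_F)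
  have skew: "\<chi> x y = - \<chi> y x" for x y
    by (rule alternating_imp_skew[OF bilinear_chi chi_self])
  fix x y z
  have step: "brk E (s x) (brk E (s y) (s z))
      = s (brk G x (brk G y z)) + i (act V x (\<chi> y z) - \<chi> (brk G y z) x)" for x y z
    using brk_coords[of y 0 z 0] brk_coords[of x 0 "brk G y z" "\<chi> y z"]
    by (simp add: i.zero bilinear_map_zero[OF bil(3)] skew[of x "brk G y z"])
  have "brk E (s x) (brk E (s y) (s z)) + brk E (s y) (brk E (s z) (s x))
      + brk E (s z) (brk E (s x) (s y)) = 0"
    using E by (simp add: nijenhuis_lie_algebra_def)
  moreover have "brk G x (brk G y z) + brk G y (brk G z x) + brk G z (brk G x y) = 0"
    using G by (simp add: nijenhuis_lie_algebra_def)
  then have "s (brk G x (brk G y z)) + s (brk G y (brk G z x)) + s (brk G z (brk G x y)) = 0"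
    by (simp add: s.zero flip: s.add)
  moreover have "brk E (s x) (brk E (s y) (s z)) + brk E (s y) (brk E (s z) (s x))
      + brk E (s z) (brk E (s x) (s y))
    = (s (brk G x (brk G y z)) + s (brk G y (brk G z x)) + s (brk G z (brk G x y)))
      + i (lie_differential G V \<chi> x y z)"
    unfolding step lie_differential_def by (simp add: i.add i.diff algebra_simps)
  ultimately have "i (lie_differential G V \<chi> x y z) = 0"
    by simp
  then show "lie_differential G V \<chi> x y z = 0"
    using i_eq_iff[of _ 0] by (simp add: i.zero)
next
  fix x y
  have Us: "nij E (s x) = s (nij G x) + i (F x)" for x
    using nij_coords[of x 0] by (simp add: i.zero S.zero)
  have l: "brk E (nij E (s x)) (nij E (s y)) = s (brk G (nij G x) (nij G y))
      + i (\<chi> (nij G x) (nij G y) + act V (nij G x) (F y) - act V (nij G y) (F x))"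
    by (simp add: Us brk_coords)
  \<comment> \<open>\<open>?b\<close> and \<open>?v\<close> are the two coordinates of the argument of \<open>U\<close> in the Nijenhuis identity.\<close>
  let ?b = "brk G (nij G x) y + brk G x (nij G y) - nij G (brk G x y)"
  let ?v = "\<chi> (nij G x) y - act V y (F x) + (\<chi> x (nij G y) + act V x (F y))
      - (F (brk G x y) + rnij V (\<chi> x y))"
  have "brk E (nij E (s x)) (s y) = s (brk G (nij G x) y) + i (\<chi> (nij G x) y - act V y (F x))"
    "brk E (s x) (nij E (s y)) = s (brk G x (nij G y)) + i (\<chi> x (nij G y) + act V x (F y))"
    "nij E (brk E (s x) (s y)) = s (nij G (brk G x y)) + i (F (brk G x y) + rnij V (\<chi> x y))"
    using brk_coords[of "nij G x" "F x" y 0] brk_coords[of x 0 "nij G y" "F y"]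
      brk_coords[of x 0 y 0] nij_coords
    by (simp_all add: Us i.zero bilinear_map_zero[OF bil(3)])
  then have "brk E (nij E (s x)) (s y) + brk E (s x) (nij E (s y)) - nij E (brk E (s x) (s y))
      = s ?b + i ?v"
    by (simp add: s.add s.diff i.add i.diff)
  then have "brk E (nij E (s x)) (nij E (s y)) = nij E (s ?b + i ?v)"
    using E unfolding nijenhuis_lie_algebra_def by metis
  then have "\<chi> (nij G x) (nij G y) + act V (nij G x) (F y) - act V (nij G y) (F x)
      = F ?b + rnij V ?v"
    unfolding l nij_coords coords_eq_iff by blast
  then show "nij_differential G V \<chi> F x y = 0"
    unfolding nij_differential_def by (simp add: S.add S.diff algebra_simps)
qed

text \<open>This form of the definition of \<open>\<tau>\<close>, in which neither the section nor an inverse of \<open>i\<close>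
  occurs, makes multiplicativity immediate. The point is that \<open>p \<circ> \<gamma>\<close> kills \<open>V\<close>, so it factors
  through \<open>p\<close>.\<close>

lemma tau_eq_iff:
  assumes "\<gamma> \<in> carrier (aut_V E i)"
  shows "tau G E i p \<gamma> = (\<beta>, \<alpha>) \<longleftrightarrow> (\<forall>v. \<gamma> (i v) = i (\<beta> v)) \<and> (\<forall>e. p (\<gamma> e) = \<alpha> (p e))"
proof -
  have lg: "Vector_Spaces.linear (scl E) (scl E) \<gamma>" and im: "\<gamma> ` range i = range i"
    using assms by (auto simp: nij_hom_def)
  interpret g: Vector_Spaces.linear "scl E" "scl E" \<gamma> by (rule lg)
  have gi: "p (\<gamma> (i v)) = 0" for v
    using im range_i by blast
  have pg: "p (\<gamma> e) = p (\<gamma> (s (p e)))" for e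
  proof -
    obtain u where e: "e = s (p e) + i u" by (rule decompose)
    show ?thesis
      by (subst e) (simp add: g.add p.add gi)
  qed
  show ?thesis
    unfolding tau_eq[OF ext assms sec] prod.inject fun_eq_iff comp_apply
    using pg p_s i_inv[OF gi] i_eq_iff by metis
qed

text \<open>The algebraic properties of \<open>\<beta>\<close> and \<open>\<alpha>\<close> are those of \<open>\<gamma>\<close>, restricted along \<open>i\<close> or pushed
  along \<open>p\<close>. Surjectivity of \<open>\<beta>\<close> and injectivity of \<open>\<alpha>\<close> both need that \<open>\<gamma>\<close> maps \<open>V\<close> onto \<open>V\<close>,
  not just into it. Compatibility holds because \<open>\<gamma> (s x)\<close> is a lift of \<open>\<alpha> x\<close>, so that its bracket
  with \<open>i (\<beta> v)\<close> is the action of \<open>\<alpha> x\<close>.\<close>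

lemma tau_mem_C_rho:
  assumes g: "\<gamma> \<in> carrier (aut_V E i)" and tau: "tau G E i p \<gamma> = (\<beta>, \<alpha>)"
  shows "(\<beta>, \<alpha>) \<in> carrier (C_rho G V)"
proof -
  have gi: "\<gamma> (i v) = i (\<beta> v)" and pg: "p (\<gamma> e) = \<alpha> (p e)" for v e
    using tau_eq_iff[OF g] tau by auto
  have hom: "nij_hom E E \<gamma>" and "bij \<gamma>" and im: "\<gamma> ` range i = range i"
    using g by auto
  interpret g: Vector_Spaces.linear "scl E" "scl E" \<gamma>
    using hom by (simp add: nij_hom_def)
  have gb: "\<gamma> (brk E a b) = brk E (\<gamma> a) (\<gamma> b)" and gU: "\<gamma> (nij E a) = nij E (\<gamma> a)" for a b
    using hom by (auto simp: nij_hom_def)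
  have a: "\<alpha> x = p (\<gamma> (s x))" for x
    by (simp add: pg)
  have "nij_hom (zero_bracket V) (zero_bracket V) \<beta>"
    unfolding nij_hom_zero_bracket_iff Vector_Spaces.linear_iff i_eq_iff[symmetric]
    using vs by (simp add: i.add i.scale g.add g.scale gU flip: gi nij_i)
  moreover have "nij_hom G G \<alpha>"
  proof -
    have "\<alpha> (brk G x y) = brk G (\<alpha> x) (\<alpha> y)" for x y
      using pg[of "brk E (s x) (s y)"] by (simp add: gb p_brk pg)
    moreover have "\<alpha> (nij G x) = nij G (\<alpha> x)" for x
      using pg[of "nij E (s x)"] by (simp add: gU p_nij pg)
    moreover have "Vector_Spaces.linear (scl G) (scl G) \<alpha>"
      unfolding Vector_Spaces.linear_iff a
      using vs by (simp add: s.add s.scale g.add g.scale p.add p.scale)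
    ultimately show ?thesis
      by (simp add: nij_hom_def)
  qed
  moreover have "bij \<beta>"
  proof (rule bijI)
    show "inj \<beta>"
      using gi \<open>bij \<gamma>\<close> inj_i by (metis bij_is_inj injD injI)
    show "surj \<beta>"
    proof (rule surj_def[THEN iffD2, rule_format])
      fix v
      have "i v \<in> \<gamma> ` range i" using im by blast
      then show "\<exists>u. v = \<beta> u" using gi i_eq_iff by auto
    qed
  qed
  moreover have "bij \<alpha>"
  proof (rule bijI)
    show "inj \<alpha>"
    proof (rule injI)
      fix x y assume "\<alpha> x = \<alpha> y"
      then have "\<gamma> (s x - s y) \<in> range i"
        by (simp add: range_i p.diff g.diff pg)
      then have "s x - s y \<in> range i"
        using im \<open>bij \<gamma>\<close> by (metis bij_is_inj inj_image_mem_iff)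
      then show "x = y"
        by (simp add: range_i p.diff)
    qed
    show "surj \<alpha>"
    proof (rule surj_def[THEN iffD2, rule_format])
      fix x
      obtain e where "\<gamma> e = s x" using \<open>bij \<gamma>\<close> by (metis bij_pointE)
      then have "x = \<alpha> (p e)"
        using pg[of e] by simp
      then show "\<exists>y. x = \<alpha> y" ..
    qed
  qed
  moreover have "\<beta> (act V x v) = act V (\<alpha> x) (\<beta> v)" for x v
    unfolding i_eq_iff[symmetric] gi[symmetric] brk_s_i[symmetric] gb
    by (simp add: gi brk_i pg)
  ultimately show ?thesis by simp
qed

text \<open>The cochain is the failure \<open>\<psi> = \<gamma> s - s \<alpha>\<close> of \<open>\<gamma>\<close> to commute with the section; the two equations
  are the \<open>V\<close>-components of \<open>\<gamma> [s x, s y] = [\<gamma> (s x), \<gamma> (s y)]\<close> and \<open>\<gamma> (U (s x)) = U (\<gamma> (s x))\<close>.\<close>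

lemma tau_imp_coboundary:
  assumes g: "\<gamma> \<in> carrier (aut_V E i)" and tau: "tau G E i p \<gamma> = (\<beta>, \<alpha>)"
  shows "\<exists>\<psi>. Vector_Spaces.linear (scl G) (rscl V) \<psi> \<and>
      (\<forall>x y. \<beta> (\<chi> x y) + \<psi> (brk G x y)
        = \<chi> (\<alpha> x) (\<alpha> y) + act V (\<alpha> x) (\<psi> y) - act V (\<alpha> y) (\<psi> x)) \<and>
      (\<forall>x. \<beta> (F x) + \<psi> (nij G x) = F (\<alpha> x) + rnij V (\<psi> x))"
proof -
  have gi: "\<gamma> (i v) = i (\<beta> v)" and pg: "p (\<gamma> e) = \<alpha> (p e)" for v e
    using tau_eq_iff[OF g] tau by auto
  have hom: "nij_hom E E \<gamma>"
    using g by auto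
  interpret g: Vector_Spaces.linear "scl E" "scl E" \<gamma>
    using hom by (simp add: nij_hom_def)
  interpret a: Vector_Spaces.linear "scl G" "scl G" \<alpha>
    using tau_mem_C_rho[OF g tau] by (simp add: nij_hom_def)
  have gb: "\<gamma> (brk E a b) = brk E (\<gamma> a) (\<gamma> b)" and gU: "\<gamma> (nij E a) = nij E (\<gamma> a)" for a b
    using hom by (auto simp: nij_hom_def)
  define \<psi> where "\<psi> x = inv_into UNIV i (\<gamma> (s x) - s (\<alpha> x))" for x
  have i_psi: "i (\<psi> x) = \<gamma> (s x) - s (\<alpha> x)" for x
    unfolding \<psi>_def by (rule i_inv) (simp add: p.diff pg)
  have gs: "\<gamma> (s x) = s (\<alpha> x) + i (\<psi> x)" for x
    by (simp add: i_psi)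
  have coords: "\<gamma> (s x + i u) = s (\<alpha> x) + i (\<psi> x + \<beta> u)" for x u
    by (simp add: g.add gs gi i.add)
  have "Vector_Spaces.linear (scl G) (rscl V) \<psi>"
    unfolding Vector_Spaces.linear_iff i_eq_iff[symmetric]
    using vs by (simp add: i.add i.scale i_psi g.add g.scale a.add a.scale s.add s.scale
        i.vs2.scale_right_diff_distrib)
  moreover have "\<beta> (\<chi> x y) + \<psi> (brk G x y)
      = \<chi> (\<alpha> x) (\<alpha> y) + act V (\<alpha> x) (\<psi> y) - act V (\<alpha> y) (\<psi> x)" for x y
  proof -
    have "brk E (s x) (s y) = s (brk G x y) + i (\<chi> x y)"
      by (simp add: i_chi)
    then have "s (\<alpha> (brk G x y)) + i (\<psi> (brk G x y) + \<beta> (\<chi> x y)) = brk E (\<gamma> (s x)) (\<gamma> (s y))"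
      using gb[of "s x" "s y"] by (simp add: coords)
    then show ?thesis
      unfolding gs brk_coords coords_eq_iff by (simp add: add.commute)
  qed
  moreover have "\<beta> (F x) + \<psi> (nij G x) = F (\<alpha> x) + rnij V (\<psi> x)" for x
  proof -
    have "nij E (s x) = s (nij G x) + i (F x)"
      by (simp add: i_F)
    then have "s (\<alpha> (nij G x)) + i (\<psi> (nij G x) + \<beta> (F x)) = nij E (\<gamma> (s x))"
      using gU[of "s x"] by (simp add: coords)
    then show ?thesis
      unfolding gs nij_coords coords_eq_iff by (simp add: add.commute)
  qed
  ultimately show ?thesis by blast
qed

text \<open>Conversely \<open>s x + i u \<mapsto> s (\<alpha> x) + i (\<psi> x + \<beta> u)\<close> is the lift. It is triangular with diagonal
  \<open>(\<alpha>, \<beta>)\<close>, hence bijective. The assumed equations cover the brackets and Nijenhuis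
  images of elements \<open>s x\<close>, and the compatibility of \<open>(\<beta>, \<alpha>)\<close> covers the mixed brackets.\<close>

lemma coboundary_imp_tau:
  assumes ba: "(\<beta>, \<alpha>) \<in> carrier (C_rho G V)"
    and l: "Vector_Spaces.linear (scl G) (rscl V) \<psi>"
    and X: "\<And>x y. \<beta> (\<chi> x y) + \<psi> (brk G x y)
        = \<chi> (\<alpha> x) (\<alpha> y) + act V (\<alpha> x) (\<psi> y) - act V (\<alpha> y) (\<psi> x)"
    and F: "\<And>x. \<beta> (F x) + \<psi> (nij G x) = F (\<alpha> x) + rnij V (\<psi> x)"
  shows "\<exists>\<gamma> \<in> carrier (aut_V E i). tau G E i p \<gamma> = (\<beta>, \<alpha>)"
proof -
  have hb: "Vector_Spaces.linear (rscl V) (rscl V) \<beta>" and bS: "\<And>v. \<beta> (rnij V v) = rnij V (\<beta> v)"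
    and ha: "nij_hom G G \<alpha>" and "bij \<alpha>" "bij \<beta>"
    and comp: "\<And>x v. \<beta> (act V x v) = act V (\<alpha> x) (\<beta> v)"
    using ba by (auto simp: nij_hom_zero_bracket_iff)
  interpret b: Vector_Spaces.linear "rscl V" "rscl V" \<beta> by (rule hb)
  interpret a: Vector_Spaces.linear "scl G" "scl G" \<alpha> using ha by (simp add: nij_hom_def)
  interpret f: Vector_Spaces.linear "scl G" "rscl V" \<psi> by (rule l)
  have ab: "\<alpha> (brk G x y) = brk G (\<alpha> x) (\<alpha> y)" and aN: "\<alpha> (nij G x) = nij G (\<alpha> x)" for x y
    using ha by (simp_all add: nij_hom_def)
  define \<gamma> where
    "\<gamma> e = s (\<alpha> (p e)) + i (\<psi> (p e) + \<beta> (inv_into UNIV i (e - s (p e))))" for e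
  have coords: "\<gamma> (s x + i u) = s (\<alpha> x) + i (\<psi> x + \<beta> u)" for x u
    by (simp add: \<gamma>_def p.add inj_i)
  have gi: "\<gamma> (i v) = i (\<beta> v)" for v
    using coords[of 0 v] by (simp add: s.zero a.zero f.zero)
  have pg: "p (\<gamma> e) = \<alpha> (p e)" for e
    by (simp add: \<gamma>_def p.add)
  have "\<gamma> (d + e) = \<gamma> d + \<gamma> e" for d e
  proof -
    obtain u v where "d = s (p d) + i u" "e = s (p e) + i v" by (meson decompose)
    then obtain x y where d: "d = s x + i u" and e: "e = s y + i v" by blast
    have "d + e = s (x + y) + i (u + v)"
      by (simp add: d e s.add i.add)
    then show ?thesis
      by (simp add: d e coords) (simp add: s.add i.add a.add f.add b.add)
  qed
  moreover have "\<gamma> (scl E r e) = scl E r (\<gamma> e)" for r e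
  proof -
    obtain u where "e = s (p e) + i u" by (rule decompose)
    then obtain x where e: "e = s x + i u" by blast
    have "scl E r e = s (scl G r x) + i (rscl V r u)"
      by (simp add: e i.vs2.scale_right_distrib s.scale i.scale)
    then show ?thesis
      by (simp add: e coords)
        (simp add: s.scale i.scale a.scale f.scale b.scale i.add i.vs2.scale_right_distrib)
  qed
  moreover have "\<gamma> (brk E d e) = brk E (\<gamma> d) (\<gamma> e)" for d e
  proof -
    obtain u v where "d = s (p d) + i u" "e = s (p e) + i v" by (meson decompose)
    then obtain x y where d: "d = s x + i u" and e: "e = s y + i v" by blast
    have "\<psi> (brk G x y) + \<beta> (\<chi> x y)
        = \<chi> (\<alpha> x) (\<alpha> y) + act V (\<alpha> x) (\<psi> y) - act V (\<alpha> y) (\<psi> x)"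
      using X[of x y] by (simp add: add.commute)
    then show ?thesis
      unfolding d e brk_coords coords coords_eq_iff
      by (simp add: ab b.add b.diff comp bilinear_map_add[OF bil(3)] algebra_simps)
  qed
  moreover have "\<gamma> (nij E e) = nij E (\<gamma> e)" for e
  proof -
    obtain u where "e = s (p e) + i u" by (rule decompose)
    then obtain x where e: "e = s x + i u" by blast
    have "\<psi> (nij G x) + \<beta> (F x) = F (\<alpha> x) + rnij V (\<psi> x)"
      using F[of x] by (simp add: add.commute)
    then show ?thesis
      unfolding e nij_coords coords coords_eq_iff
      by (simp add: aN b.add S.add bS add.assoc[symmetric])
  qed
  ultimately have "nij_hom E E \<gamma>"
    using vs by (simp add: nij_hom_def Vector_Spaces.linear_iff)
  moreover have "bij \<gamma>"
  proof (rule bijI)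
    show "inj \<gamma>"
    proof (rule injI)
      fix d e assume "\<gamma> d = \<gamma> e"
      moreover obtain u v where "d = s (p d) + i u" "e = s (p e) + i v" by (meson decompose)
      then obtain x y where d: "d = s x + i u" and e: "e = s y + i v" by blast
      ultimately have "\<alpha> x = \<alpha> y" and *: "\<psi> x + \<beta> u = \<psi> y + \<beta> v"
        unfolding d e coords coords_eq_iff by auto
      then have "x = y" using \<open>bij \<alpha>\<close> by (meson bij_is_inj injD)
      with * have "\<beta> u = \<beta> v" by simp
      then have "u = v" using \<open>bij \<beta>\<close> by (meson bij_is_inj injD)
      then show "d = e" using \<open>x = y\<close> d e by simp
    qed
    show "surj \<gamma>"
    proof (rule surj_def[THEN iffD2, rule_format])
      fix e
      obtain u where e: "e = s (p e) + i u" by (rule decompose)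
      obtain x where x: "\<alpha> x = p e" using \<open>bij \<alpha>\<close> by (metis bij_pointE)
      obtain v where v: "\<beta> v = u - \<psi> x" using \<open>bij \<beta>\<close> by (metis bij_pointE)
      have "\<gamma> (s x + i v) = s (p e) + i u"
        by (simp add: coords x v)
      then have "e = \<gamma> (s x + i v)"
        by (rule trans[OF e sym])
      then show "\<exists>d. e = \<gamma> d" ..
    qed
  qed
  moreover have "\<gamma> ` range i = range i"
  proof -
    have "\<gamma> ` range i = i ` range \<beta>"
      by (auto simp: gi image_iff)
    then show ?thesis using \<open>bij \<beta>\<close> by (simp add: bij_is_surj)
  qed
  ultimately have mem: "\<gamma> \<in> carrier (aut_V E i)" by simp
  then show ?thesis
    using tau_eq_iff[OF mem] gi pg by blast
qed

lemma image_tau_iff: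
  "(\<exists>\<gamma> \<in> carrier (aut_V E i). tau G E i p \<gamma> = (\<beta>, \<alpha>)) \<longleftrightarrow>
     (\<beta>, \<alpha>) \<in> carrier (C_rho G V) \<and> wells G V E i p (\<beta>, \<alpha>) = H2_zero G V"
  (is "?L \<longleftrightarrow> ?C \<and> ?W")
proof -
  have W: "?W \<longleftrightarrow> (\<exists>\<psi>. Vector_Spaces.linear (scl G) (rscl V) \<psi> \<and>
      (\<forall>x y. \<beta> (\<chi> x y) + \<psi> (brk G x y)
        = \<chi> (\<alpha> x) (\<alpha> y) + act V (\<alpha> x) (\<psi> y) - act V (\<alpha> y) (\<psi> x)) \<and>
      (\<forall>x. \<beta> (F x) + \<psi> (nij G x) = F (\<alpha> x) + rnij V (\<psi> x)))" if ?C
    unfolding wells_eq[OF ext that sec] section_cocycle_eq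
    by (rule wells_of_cocycle_eq_zero_iff[OF G V that])
  show ?thesis
  proof
    assume ?L
    then obtain \<gamma> where g: "\<gamma> \<in> carrier (aut_V E i)" "tau G E i p \<gamma> = (\<beta>, \<alpha>)" by blast
    then have ?C by (rule tau_mem_C_rho)
    then show "?C \<and> ?W" using W tau_imp_coboundary[OF g] by blast
  next
    assume "?C \<and> ?W"
    then show ?L using W coboundary_imp_tau by blast
  qed
qed

lemma wells_mem_H2: "wells G V E i p \<in> carrier (C_rho G V) \<rightarrow> H2 G V"
proof
  fix c assume c: "c \<in> carrier (C_rho G V)"
  obtain \<beta> \<alpha> where eq: "c = (\<beta>, \<alpha>)" by (cases c)
  show "wells G V E i p c \<in> H2 G V"
    using wells_of_cocycle_mem_H2[OF V c[unfolded eq] cocycle]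
    by (simp only: eq wells_eq[OF ext c[unfolded eq] sec] section_cocycle_eq)
qed

lemma group_hom_tau: "group_hom (aut_V E i) (C_rho G V) (tau G E i p)"
  unfolding group_hom_def group_hom_axioms_def
proof (intro conjI group_aut_V group_C_rho vs homI)
  fix \<gamma> assume g: "\<gamma> \<in> carrier (aut_V E i)"
  show "tau G E i p \<gamma> \<in> carrier (C_rho G V)"
    by (cases "tau G E i p \<gamma>") (metis tau_mem_C_rho[OF g])
next
  fix \<gamma> \<delta> assume g: "\<gamma> \<in> carrier (aut_V E i)" and d: "\<delta> \<in> carrier (aut_V E i)"
  obtain \<beta> \<alpha> \<beta>' \<alpha>' where eq: "tau G E i p \<gamma> = (\<beta>, \<alpha>)" "tau G E i p \<delta> = (\<beta>', \<alpha>')"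
    by (meson surj_pair)
  interpret A: group "aut_V E i" by (rule group_aut_V[OF vs(1)])
  have "tau G E i p (\<gamma> \<otimes>\<^bsub>aut_V E i\<^esub> \<delta>) = (\<beta> \<circ> \<beta>', \<alpha> \<circ> \<alpha>')"
    unfolding tau_eq_iff[OF A.m_closed[OF g d]]
    using tau_eq_iff[OF g, THEN iffD1, OF eq(1)] tau_eq_iff[OF d, THEN iffD1, OF eq(2)] by simp
  then show "tau G E i p (\<gamma> \<otimes>\<^bsub>aut_V E i\<^esub> \<delta>) = tau G E i p \<gamma> \<otimes>\<^bsub>C_rho G V\<^esub> tau G E i p \<delta>"
    by (simp add: eq)
qed

end

section \<open>The Wells exact sequence\<close>

theorem theorem4p6:
  fixes G :: "('k::field, 'g::ab_group_add) nij_lie"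
    and V :: "('k, 'g, 'v::ab_group_add) nij_rep"
    and E :: "('k, 'e::ab_group_add) nij_lie"
    and i :: "'v \<Rightarrow> 'e" and p :: "'e \<Rightarrow> 'g"
  assumes "abelian_extension G V E i p"
  shows
    "(\<forall>\<beta> \<in> carrier (nij_aut (zero_bracket V)). \<forall>\<alpha> \<in> carrier (nij_aut G).
        inducible G E i p (\<beta>, \<alpha>) \<longleftrightarrow>
          (\<beta>, \<alpha>) \<in> carrier (C_rho G V) \<and> wells G V E i p (\<beta>, \<alpha>) = H2_zero G V)
     \<and> (group_hom (aut_V_g G E i p) (aut_V E i) (\<lambda>\<gamma>. \<gamma>) \<and>
        group_hom (aut_V E i) (C_rho G V) (tau G E i p) \<and>
        wells G V E i p \<in> carrier (C_rho G V) \<rightarrow> H2 G V \<and>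
        kernel (aut_V_g G E i p) (aut_V E i) (\<lambda>\<gamma>. \<gamma>) = {\<one>\<^bsub>aut_V_g G E i p\<^esub>} \<and>
        (\<lambda>\<gamma>. \<gamma>) ` carrier (aut_V_g G E i p) = kernel (aut_V E i) (C_rho G V) (tau G E i p) \<and>
        tau G E i p ` carrier (aut_V E i)
          = {c \<in> carrier (C_rho G V). wells G V E i p c = H2_zero G V})"
proof -
  interpret split_extension G V E i p "the_section G E p"
    by unfold_locales (use assms the_section in auto)
  interpret tau: group_hom "aut_V E i" "C_rho G V" "tau G E i p"
    by (rule group_hom_tau)
  have K: "kernel (aut_V E i) (C_rho G V) (tau G E i p)
      = {\<gamma> \<in> carrier (aut_V E i). tau G E i p \<gamma> = (id, id)}"
    by (simp add: kernel_def)
  have aut_V_g: "aut_V_g G E i p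
      = (aut_V E i)\<lparr>carrier := kernel (aut_V E i) (C_rho G V) (tau G E i p)\<rparr>"
    unfolding K aut_V_g_def ..
  have sub: "subgroup (kernel (aut_V E i) (C_rho G V) (tau G E i p)) (aut_V E i)"
    by (rule tau.subgroup_kernel)
  have "group (aut_V_g G E i p)"
    unfolding aut_V_g by (rule group.subgroup_imp_group[OF group_aut_V[OF vs(1)] sub])
  then have incl: "group_hom (aut_V_g G E i p) (aut_V E i) (\<lambda>\<gamma>. \<gamma>)"
    unfolding group_hom_def group_hom_axioms_def
    by (intro conjI group_aut_V vs homI)
      (use subgroup.mem_carrier[OF sub] in \<open>simp_all add: aut_V_g del: aut_V_simps\<close>)
  have ker: "kernel (aut_V_g G E i p) (aut_V E i) (\<lambda>\<gamma>. \<gamma>) = {\<one>\<^bsub>aut_V_g G E i p\<^esub>}"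
    unfolding kernel_def[of "aut_V_g G E i p"]
    using subgroup.one_closed[OF sub] by (auto simp: aut_V_g)
  have im: "tau G E i p ` carrier (aut_V E i)
      = {c \<in> carrier (C_rho G V). wells G V E i p c = H2_zero G V}"
  proof (rule Set.set_eqI)
    fix c :: "('v \<Rightarrow> 'v) \<times> ('g \<Rightarrow> 'g)"
    obtain \<beta> \<alpha> where c: "c = (\<beta>, \<alpha>)" by (cases c)
    have "c \<in> tau G E i p ` carrier (aut_V E i) \<longleftrightarrow>
        (\<exists>\<gamma> \<in> carrier (aut_V E i). tau G E i p \<gamma> = (\<beta>, \<alpha>))"
      unfolding c image_iff by (rule bex_cong[OF refl eq_commute])
    then show "c \<in> tau G E i p ` carrier (aut_V E i) \<longleftrightarrow>
        c \<in> {c \<in> carrier (C_rho G V). wells G V E i p c = H2_zero G V}"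
      unfolding image_tau_iff unfolding c by blast
  qed
  have ind: "inducible G E i p (\<beta>, \<alpha>) \<longleftrightarrow>
      (\<beta>, \<alpha>) \<in> carrier (C_rho G V) \<and> wells G V E i p (\<beta>, \<alpha>) = H2_zero G V" for \<beta> \<alpha>
    unfolding inducible_def image_tau_iff[symmetric] by (rule bex_cong[OF refl eq_commute])
  have ex: "(\<lambda>\<gamma>. \<gamma>) ` carrier (aut_V_g G E i p)
      = kernel (aut_V E i) (C_rho G V) (tau G E i p)"
    by (simp add: aut_V_g)
  show ?thesis
    by (intro conjI ballI ind incl group_hom_tau wells_mem_H2 ker ex im)
qed

end
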